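(* Consider the algorithm SC-AccExtragradient (described in the context) applied to $\min_{x\in\mathbb{R}^d} h(x)$, $h=f+g$, where (i) $h$ is $\mu$-strongly convex with $\mu>0$, i.e. $h(x)\ge h(y)+\langle\nabla h(y),x-y\rangle+\frac{\mu}{2}\|x-y\|^2$ for all $x,y\in\mathbb{R}^d$; (ii) $\|\nabla^2 f_1(x)-\nabla^2 f(x)\|\le\delta_f$ and $\|\nabla^2 g_1(x)-\nabla^2 g(x)\|\le\delta_g$ for all $x\in\mathbb{R}^d$, with $\mu<\delta_f<\delta_g$; (iii) the stochastic oracles satisfy, for all $k$, $\mathbb{E}_{\xi_k}\left[\|\xi_k-\nabla(h-h_1)(\underline{x}_k)\|^2\right]\le\sigma^2$ and $\mathbb{E}_{\zeta_k}\left[\|\zeta_k-\nabla h(\overline{x}_{k+1})\|^2\right]\le\sigma^2$. Let the subproblem in each iteration be solved approximately so that $$\mathbb{E}\left[\|\nabla A_\theta^k(\overline{x}_{k+1})\|^2\right]\le\mathbb{E}\left[\frac{1}{11\theta^2}\Big\|\underline{x}_k-\arg\min_{x\in\mathbb{R}^d}A_\theta^k(x)\Big\|^2\right].$$ Then the parameters can be chosen, with $$\theta\le\frac{1}{3(\delta_f+\delta_g)},\quad \tau=\sqrt{\mu\theta},\quad \eta=\min\left\{\frac{1}{2\mu},\frac12\sqrt{\frac{\theta}{\mu}}\right\},\quad \alpha=\mu,$$ and a suitable $p\in(0,1)$, so that the (expected) number of communication rounds needed to reach an $\varepsilon$-solution is $$\mathcal{O}\left(\sqrt{\frac{\delta_f}{\mu}}\log\frac1\varepsilon+\frac{\sigma^2}{\mu\varepsilon}\right)\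 \text{for the nodes from } M_f,\qquad \mathcal{O}\left(\sqrt{\frac{\delta_g}{\mu}}\log\frac1\varepsilon+\frac{\sigma^2}{\mu\varepsilon}\right)\ \text{for the nodes from } M_g.$$
   Context: Problem: $\min_{x\in\mathbb{R}^d} h(x)$, $h=f+g$, with $f=\frac{1}{|M_f|}\sum_{m\in M_f}f_m$ and $g=\frac{1}{|M_g|}\sum_{m\in M_g}g_m$, all functions twice differentiable on $\mathbb{R}^d$ and otherwise arbitrary (in particular $f,g$ may be non-convex). $M_f,M_g$ are finite sets of nodes. A server holds $f_1$ and $g_1$, and $h_1=f_1+g_1$. $x_*$ denotes the minimizer of $h$. Norms are Euclidean for vectors and operator (spectral) for matrices. Communication rounds: computations with $f_1,g_1,h_1$ are free. Each evaluation of $\nabla f$ (or $\nabla(f-f_1)$) at a point costs one communication round for the nodes of $M_f$; each evaluation of $\nabla g$ (or $\nabla(g-g_1)$) at a point costs one communication round for the nodes of $M_g$. SC-AccExtragradient: input $x_0=\overline{x}_0\in\mathbb{R}^d$; parameters $\tau\in(0,1)$, $p\in(0,1)$, $\eta,\theta,\alpha>0$, number of iterations $K$. For $k=0,\dots,K-1$: 1. $\underline{x}_k=\tau x_k+(1-\tau)\overline{x}_k$. 2. $\xi_k=\frac1p\nabla(f-f_1)(\underline{x}_k)$ with probability $p$, and $\xi_k=\frac{1}{1-p}\nabla(g-g_1)(\underline{x}_k)$ with probability $1-p$. 3. $\overline{x}_{k+1}\approx\arg\min_{x}A_\theta^k(x)$, where $A_\theta^k(x)=\langle\xi_k,x\rangle+\frac{1}{2\theta}\|x-\underline{x}_k\|^2+h_1(x)$.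 4. $\zeta_k=\frac1p\nabla f(\overline{x}_{k+1})$ with probability $p$, and $\zeta_k=\frac{1}{1-p}\nabla g(\overline{x}_{k+1})$ with probability $1-p$. 5. $x_{k+1}=x_k+\eta\alpha(\overline{x}_{k+1}-x_k)-\eta\zeta_k$. Output $x_K$. All random choices are mutually independent. $\mathbb{E}_{\xi_k}$, $\mathbb{E}_{\zeta_k}$ denote expectation over the random choice in step 2, respectively step 4, only. An $\varepsilon$-solution means that the output satisfies $\mu\,\mathbb{E}\|x_K-x_*\|^2\le\varepsilon$. $\mathcal{O}(\cdot)$ hides absolute constants, and $\log\frac1\varepsilon$ is understood up to the dependence of its argument on the initial point (i.e. $\log\frac{C_0}{\varepsilon}$ with $C_0$ determined by the initial error).
   Formalization: With constant θ, τ, η the noise term needs an extra log factor (already for 1-d quadratics), so θ, τ, η may vary with k, keeping the stated relations; they are constant whenever σ²/(με) ≤ √(δ_g/μ). C_0 bounds μ‖x_0−x_*‖²+h(x_0)−h(x_* ). *)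

theory Defs
  imports "HOL-Probability.Probability"
begin

definition grad :: "('a::euclidean_space \<Rightarrow> real) \<Rightarrow> 'a \<Rightarrow> 'a" where
  "grad F x = (THE D. GDERIV F x :> D)"

definition hess :: "('a::euclidean_space \<Rightarrow> real) \<Rightarrow> 'a \<Rightarrow> 'a \<Rightarrow> 'a" where
  "hess F x = frechet_derivative (grad F) (at x)"

definition twice_differentiable :: "('a::euclidean_space \<Rightarrow> real) \<Rightarrow> bool" where
  "twice_differentiable F \<longleftrightarrow>
     (\<forall>x. F differentiable (at x)) \<and> (\<forall>x. grad F differentiable (at x))"

definition strongly_convex :: "real \<Rightarrow> ('a::euclidean_space \<Rightarrow> real) \<Rightarrow> bool" where
  "strongly_convex \<mu> F \<longleftrightarrow>
     (\<forall>x y. F x \<ge> F y + grad F y \<bullet> (x - y) + \<mu> / 2 * (norm (x - y))\<^sup>2)"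

definition hessian_similar ::
  "real \<Rightarrow> ('a::euclidean_space \<Rightarrow> real) \<Rightarrow> ('a \<Rightarrow> real) \<Rightarrow> bool" where
  "hessian_similar \<delta> F1 F \<longleftrightarrow> (\<forall>x. onorm (\<lambda>v. hess F1 x v - hess F x v) \<le> \<delta>)"

definition minimizer :: "('a \<Rightarrow> real) \<Rightarrow> 'a" where
  "minimizer F = arg_min F (\<lambda>_. True)"


section \<open>The composite problem\<close>

text \<open>The functions with index 1 are the ones held by the server.\<close>

record 'a problem =
  nodes_f :: "nat set"
  nodes_g :: "nat set"
  loss_f :: "nat \<Rightarrow> 'a \<Rightarrow> real"
  loss_g :: "nat \<Rightarrow> 'a \<Rightarrow> real"

definition obj_f :: "'a problem \<Rightarrow> 'a \<Rightarrow> real" where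
  "obj_f P x = (\<Sum>m\<in>nodes_f P. loss_f P m x) / real (card (nodes_f P))"

definition obj_g :: "'a problem \<Rightarrow> 'a \<Rightarrow> real" where
  "obj_g P x = (\<Sum>m\<in>nodes_g P. loss_g P m x) / real (card (nodes_g P))"

definition obj_h :: "'a problem \<Rightarrow> 'a \<Rightarrow> real" where
  "obj_h P x = obj_f P x + obj_g P x"

definition server_f :: "'a problem \<Rightarrow> 'a \<Rightarrow> real" where
  "server_f P = loss_f P 1"

definition server_g :: "'a problem \<Rightarrow> 'a \<Rightarrow> real" where
  "server_g P = loss_g P 1"

definition server_h :: "'a problem \<Rightarrow> 'a \<Rightarrow> real" where
  "server_h P x = server_f P x + server_g P x"

definition composite_problem :: "'a::euclidean_space problem \<Rightarrow> bool" where
  "composite_problem P \<longleftrightarrow>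
     finite (nodes_f P) \<and> nodes_f P \<noteq> {} \<and> finite (nodes_g P) \<and> nodes_g P \<noteq> {} \<and>
     (\<forall>m\<in>insert 1 (nodes_f P). twice_differentiable (loss_f P m)) \<and>
     (\<forall>m\<in>insert 1 (nodes_g P). twice_differentiable (loss_g P m))"


section \<open>The algorithm\<close>

text \<open>
  The parameters \<open>\<theta>\<close>, \<open>\<tau>\<close>, \<open>\<eta>\<close> are sequences indexed by the iteration; constant parameters
  are constant sequences.  The schedule matters only if noise dominates: with constant
  parameters the iteration count has a term of order \<open>\<sigma>\<^sup>2 / (\<mu> * \<epsilon>) * ln (1 / \<epsilon>)\<close>, already for a
  quadratic objective, and decreasing \<open>\<theta>\<close> removes the logarithm.
\<close>

record params =
  theta :: "nat \<Rightarrow> real"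
  tau :: "nat \<Rightarrow> real"
  eta :: "nat \<Rightarrow> real"
  alpha :: real
  prob_f :: real
  iters :: nat

definition admissible :: "params \<Rightarrow> bool" where
  "admissible \<pi> \<longleftrightarrow>
     (\<forall>k. 0 < theta \<pi> k \<and> 0 < tau \<pi> k \<and> tau \<pi> k < 1 \<and> 0 < eta \<pi> k) \<and>
     0 < alpha \<pi> \<and> 0 < prob_f \<pi> \<and> prob_f \<pi> < 1"

definition constant_params :: "params \<Rightarrow> bool" where
  "constant_params \<pi> \<longleftrightarrow>
     (\<forall>k. theta \<pi> k = theta \<pi> 0 \<and> tau \<pi> k = tau \<pi> 0 \<and> eta \<pi> k = eta \<pi> 0)"

definition oracle_xi :: "'a::euclidean_space problem \<Rightarrow> params \<Rightarrow> bool \<Rightarrow> 'a \<Rightarrow> 'a" where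
  "oracle_xi P \<pi> b y =
     (if b then (1 / prob_f \<pi>) *\<^sub>R grad (\<lambda>z. obj_f P z - server_f P z) y
      else (1 / (1 - prob_f \<pi>)) *\<^sub>R grad (\<lambda>z. obj_g P z - server_g P z) y)"

definition oracle_zeta :: "'a::euclidean_space problem \<Rightarrow> params \<Rightarrow> bool \<Rightarrow> 'a \<Rightarrow> 'a" where
  "oracle_zeta P \<pi> b y =
     (if b then (1 / prob_f \<pi>) *\<^sub>R grad (obj_f P) y
      else (1 / (1 - prob_f \<pi>)) *\<^sub>R grad (obj_g P) y)"

text \<open>
  A run lives on a probability space \<open>law\<close>.  The choices of the two oracles in iteration \<open>k\<close> are
  \<open>choice_xi k\<close> and \<open>choice_zeta k\<close>, where \<open>True\<close> stands for the nodes of \<open>f\<close>.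
  The sigma-algebras \<open>info_xi k\<close> and \<open>info_zeta k\<close> contain all that is determined before the
  respective choice is made.  They may also contain internal randomness of the method that solves
  the subproblems.
\<close>

record ('w, 'a) run =
  law :: "'w measure"
  info_xi :: "nat \<Rightarrow> 'w measure"
  info_zeta :: "nat \<Rightarrow> 'w measure"
  choice_xi :: "nat \<Rightarrow> 'w \<Rightarrow> bool"
  choice_zeta :: "nat \<Rightarrow> 'w \<Rightarrow> bool"
  iter :: "nat \<Rightarrow> 'w \<Rightarrow> 'a"
  iter_bar :: "nat \<Rightarrow> 'w \<Rightarrow> 'a"

definition iter_under ::
  "params \<Rightarrow> ('w, 'a::euclidean_space) run \<Rightarrow> nat \<Rightarrow> 'w \<Rightarrow> 'a" where
  "iter_under \<pi> R k \<omega> = tau \<pi> k *\<^sub>R iter R k \<omega> + (1 - tau \<pi> k) *\<^sub>R iter_bar R k \<omega>"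

definition xi ::
  "'a::euclidean_space problem \<Rightarrow> params \<Rightarrow> ('w, 'a) run \<Rightarrow> nat \<Rightarrow> 'w \<Rightarrow> 'a" where
  "xi P \<pi> R k \<omega> = oracle_xi P \<pi> (choice_xi R k \<omega>) (iter_under \<pi> R k \<omega>)"

definition zeta ::
  "'a::euclidean_space problem \<Rightarrow> params \<Rightarrow> ('w, 'a) run \<Rightarrow> nat \<Rightarrow> 'w \<Rightarrow> 'a" where
  "zeta P \<pi> R k \<omega> = oracle_zeta P \<pi> (choice_zeta R k \<omega>) (iter_bar R (Suc k) \<omega>)"

definition subproblem ::
  "'a::euclidean_space problem \<Rightarrow> params \<Rightarrow> ('w, 'a) run \<Rightarrow> nat \<Rightarrow> 'w \<Rightarrow> 'a \<Rightarrow> real" where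
  "subproblem P \<pi> R k \<omega> x =
     xi P \<pi> R k \<omega> \<bullet> x
     + 1 / (2 * theta \<pi> k) * (norm (x - iter_under \<pi> R k \<omega>))\<^sup>2
     + server_h P x"

definition fresh_choice :: "'w measure \<Rightarrow> 'w measure \<Rightarrow> real \<Rightarrow> ('w \<Rightarrow> bool) \<Rightarrow> bool" where
  "fresh_choice M F p b \<longleftrightarrow>
     distr M (count_space UNIV) b = measure_pmf (bernoulli_pmf p) \<and>
     prob_space.indep_set M (sets F) (sets (vimage_algebra (space M) b (count_space UNIV)))"

text \<open>
  The independence of each choice of everything before it makes all choices mutually independent.
  The quality of \<open>iter_bar (Suc k)\<close> as a solution of the subproblem is a separate condition.
\<close>

definition sc_acc_extragradient ::
  "'a::euclidean_space problem \<Rightarrow> params \<Rightarrow> 'a \<Rightarrow> ('w, 'a) run \<Rightarrow> bool" where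
  "sc_acc_extragradient P \<pi> x0 R \<longleftrightarrow>
     prob_space (law R) \<and>
     (\<forall>k. subalgebra (law R) (info_xi R k) \<and> subalgebra (law R) (info_zeta R k) \<and>
          sets (info_xi R k) \<subseteq> sets (info_zeta R k) \<and>
          sets (info_zeta R k) \<subseteq> sets (info_xi R (Suc k))) \<and>
     (\<forall>\<omega>\<in>space (law R). iter R 0 \<omega> = x0 \<and> iter_bar R 0 \<omega> = x0) \<and>
     (\<forall>k<iters \<pi>.
        fresh_choice (law R) (info_xi R k) (prob_f \<pi>) (choice_xi R k) \<and>
        choice_xi R k \<in> measurable (info_zeta R k) (count_space UNIV) \<and>
        iter_bar R (Suc k) \<in> borel_measurable (info_zeta R k) \<and>
        fresh_choice (law R) (info_zeta R k) (prob_f \<pi>) (choice_zeta R k) \<and>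
        choice_zeta R k \<in> measurable (info_xi R (Suc k)) (count_space UNIV) \<and>
        (\<forall>\<omega>\<in>space (law R).
           iter R (Suc k) \<omega> =
             iter R k \<omega> + (eta \<pi> k * alpha \<pi>) *\<^sub>R (iter_bar R (Suc k) \<omega> - iter R k \<omega>)
             - eta \<pi> k *\<^sub>R zeta P \<pi> R k \<omega>))"

definition bounded_oracle_variance ::
  "'a::euclidean_space problem \<Rightarrow> params \<Rightarrow> ('w, 'a) run \<Rightarrow> real \<Rightarrow> bool" where
  "bounded_oracle_variance P \<pi> R \<sigma> \<longleftrightarrow>
     (\<forall>k<iters \<pi>. AE \<omega> in law R.
        measure_pmf.expectation (bernoulli_pmf (prob_f \<pi>))
          (\<lambda>b. (norm (oracle_xi P \<pi> b (iter_under \<pi> R k \<omega>)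
                      - grad (\<lambda>z. obj_h P z - server_h P z) (iter_under \<pi> R k \<omega>)))\<^sup>2) \<le> \<sigma>\<^sup>2 \<and>
        measure_pmf.expectation (bernoulli_pmf (prob_f \<pi>))
          (\<lambda>b. (norm (oracle_zeta P \<pi> b (iter_bar R (Suc k) \<omega>)
                      - grad (obj_h P) (iter_bar R (Suc k) \<omega>)))\<^sup>2) \<le> \<sigma>\<^sup>2)"

text \<open>
  Expectations of squared norms along a run are nonnegative integrals, so they are meaningful
  without integrability assumptions.
\<close>

definition subproblems_solved ::
  "'a::euclidean_space problem \<Rightarrow> params \<Rightarrow> ('w, 'a) run \<Rightarrow> bool" where
  "subproblems_solved P \<pi> R \<longleftrightarrow>
     (\<forall>k<iters \<pi>.
        (\<integral>\<^sup>+\<omega>. ennreal ((norm (grad (subproblem P \<pi> R k \<omega>) (iter_bar R (Suc k) \<omega>)))\<^sup>2) \<partial>law R)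
        \<le> (\<integral>\<^sup>+\<omega>. ennreal (1 / (11 * (theta \<pi> k)\<^sup>2) *
              (norm (iter_under \<pi> R k \<omega> - minimizer (subproblem P \<pi> R k \<omega>)))\<^sup>2) \<partial>law R))"

definition eps_solution ::
  "'a::euclidean_space problem \<Rightarrow> params \<Rightarrow> ('w, 'a) run \<Rightarrow> real \<Rightarrow> real \<Rightarrow> bool" where
  "eps_solution P \<pi> R \<mu> \<epsilon> \<longleftrightarrow>
     ennreal \<mu> *
       (\<integral>\<^sup>+\<omega>. ennreal ((norm (iter R (iters \<pi>) \<omega> - minimizer (obj_h P)))\<^sup>2) \<partial>law R)
     \<le> ennreal \<epsilon>"

definition rounds_f :: "params \<Rightarrow> ('w, 'a) run \<Rightarrow> 'w \<Rightarrow> nat" where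
  "rounds_f \<pi> R \<omega> =
     (\<Sum>k<iters \<pi>. of_bool (choice_xi R k \<omega>) + of_bool (choice_zeta R k \<omega>))"

definition rounds_g :: "params \<Rightarrow> ('w, 'a) run \<Rightarrow> 'w \<Rightarrow> nat" where
  "rounds_g \<pi> R \<omega> =
     (\<Sum>k<iters \<pi>. of_bool (\<not> choice_xi R k \<omega>) + of_bool (\<not> choice_zeta R k \<omega>))"

text \<open>
  Since \<open>h\<close> need not be smooth, its gap at the starting point is not controlled by the distance to
  the minimizer, so both belong to the initial error.
\<close>

definition initial_error ::
  "'a::euclidean_space problem \<Rightarrow> real \<Rightarrow> 'a \<Rightarrow> real" where
  "initial_error P \<mu> x0 =
     \<mu> * (norm (x0 - minimizer (obj_h P)))\<^sup>2 + (obj_h P x0 - obj_h P (minimizer (obj_h P)))"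

text \<open>
  A number instead of an existentially quantified constant: inside a theorem with a type variable
  for the Euclidean space such a constant could depend on the dimension.
\<close>

definition abs_const :: real where
  "abs_const = 1000"

end

theory Submission
  imports Defs
begin

text \<open>
  Write \<open>u\<close> for the extrapolated point, \<open>y\<close> for the approximate solution of the subproblem, \<open>q = h - h\<^sub>1\<close>
  and \<open>x\<^sub>*\<close> for the minimizer of \<open>h\<close>.  By Hessian similarity \<open>\<nabla>q\<close> is Lipschitz with constant
  \<open>L = \<delta>\<^sub>f + \<delta>\<^sub>g\<close>, and \<open>h\<close> is convex, so for \<open>3 L \<theta> \<le> 1\<close> the subproblem is strongly convex, although
  \<open>f\<close>, \<open>g\<close> and \<open>h\<^sub>1\<close> may be non-convex.  Its optimality condition says that \<open>y - u\<close> is \<open>- \<theta> \<nabla>h(y)\<close> up to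
  \<open>\<theta>\<close> times three errors: the variation of \<open>\<nabla>q\<close> between \<open>u\<close> and \<open>y\<close>, the noise of the first oracle and the residual of the subproblem.  The mean square of \<open>\<theta>\<close> times
  their sum is at most \<open>E \<bar>y - u\<bar>\<^sup>2 + 5 \<theta>\<^sup>2 \<sigma>\<^sup>2\<close>, and polarization yields the descent inequality
  \<open>E \<langle>\<nabla>h(y), y - u\<rangle> \<le> 5/2 \<theta> \<sigma>\<^sup>2 - \<theta>/2 E \<bar>\<nabla>h(y)\<bar>\<^sup>2\<close> (\<open>extragradient_descent\<close>, \<open>descent_expectation\<close>).

  Linear coupling (\<open>coupling_step\<close>) combines it with the step from \<open>x\<^sub>k\<close> to \<open>x\<^sub>k\<^sub>+\<^sub>1\<close>.  With \<open>\<theta> = \<tau>\<^sup>2 / \<mu>\<close> and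
  \<open>\<eta> = \<tau> / (2 \<mu>)\<close> the potential \<open>\<mu> E \<bar>x\<^sub>k - x\<^sub>*\<bar>\<^sup>2 + (1 - \<tau>\<^sub>k) E (h(xbar\<^sub>k) - h(x\<^sub>*))\<close> contracts by the factor
  \<open>1 - \<tau>\<^sub>k / 2\<close> up to an error \<open>3 \<sigma>\<^sup>2 \<tau>\<^sub>k\<^sup>2 / \<mu>\<close> (\<open>potential_Suc\<close>).  All these expectations are finite: the
  iterates stay square integrable, which is proved along with the recursion by comparing the exact
  solution of the subproblem with \<open>x\<^sub>*\<close>.

  What remains is a recursion for real numbers.  For moderate noise a constant \<open>\<tau>\<close> of order \<open>sqrt (\<mu> / L)\<close>
  is enough.  Otherwise the largest such \<open>\<tau>\<close> is used until the error is comparable with the noise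
  floor, and then \<open>\<tau>\<^sub>k\<close> decays like \<open>4 / k\<close>, which costs \<open>O(\<sigma>\<^sup>2 / (\<mu> \<epsilon>))\<close> further iterations.  In total there
  are \<open>O(sqrt (L / \<mu>) ln (C\<^sub>0 / \<epsilon>) + \<sigma>\<^sup>2 / (\<mu> \<epsilon>))\<close> iterations.  Each makes two calls, and
  a call goes to the nodes of \<open>f\<close> with probability \<open>p = sqrt \<delta>\<^sub>f / (sqrt \<delta>\<^sub>f + sqrt \<delta>\<^sub>g)\<close>.  The inequality
  \<open>sqrt L \<le> sqrt \<delta>\<^sub>f + sqrt \<delta>\<^sub>g\<close> turns the number of iterations into the two numbers of rounds.
\<close>


section \<open>Gradients\<close>

lemma grad_eqI:
  assumes "GDERIV F x :> D"
  shows "grad F x = D"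
  unfolding grad_def
proof (rule the_equality)
  fix D' assume "GDERIV F x :> D'"
  with assms have "(\<lambda>v. v \<bullet> D) = (\<lambda>v. v \<bullet> D')"
    unfolding gderiv_def by (rule has_derivative_unique)
  then have "v \<bullet> D = v \<bullet> D'" for v
    by (rule fun_cong)
  then show "D' = D"
    using vector_eq_ldot[of D D'] by simp
qed (fact assms)

lemma GDERIV_grad:
  fixes F :: "'a::euclidean_space \<Rightarrow> real"
  assumes "F differentiable (at x)"
  shows "GDERIV F x :> grad F x"
proof -
  obtain F' where F': "(F has_derivative F') (at x)"
    using assms unfolding differentiable_def by blast
  interpret F': bounded_linear F' using F' by (rule has_derivative_bounded_linear)
  let ?D = "\<Sum>b\<in>Basis. F' b *\<^sub>R b"
  have "F' v = v \<bullet> ?D" for v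
  proof -
    have "F' v = F' (\<Sum>b\<in>Basis. (v \<bullet> b) *\<^sub>R b)" by (simp add: euclidean_representation)
    also have "\<dots> = v \<bullet> ?D"
      by (simp add: F'.sum F'.scaleR inner_sum_right mult.commute)
    finally show ?thesis .
  qed
  then have "F' = (\<lambda>v. v \<bullet> ?D)"
    by (rule ext)
  then have "GDERIV F x :> ?D"
    using F' unfolding gderiv_def by simp
  then show ?thesis
    using grad_eqI[of F x ?D] by simp
qed

lemma differentiable_GDERIV: "GDERIV F x :> D \<Longrightarrow> F differentiable (at x)"
  unfolding gderiv_def differentiable_def by blast

lemma grad_add:
  fixes F G :: "'a::euclidean_space \<Rightarrow> real"
  assumes "F differentiable (at x)" "G differentiable (at x)"
  shows "grad (\<lambda>z. F z + G z) x = grad F x + grad G x"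
  by (intro grad_eqI GDERIV_add GDERIV_grad assms)

lemma grad_diff:
  fixes F G :: "'a::euclidean_space \<Rightarrow> real"
  assumes "F differentiable (at x)" "G differentiable (at x)"
  shows "grad (\<lambda>z. F z - G z) x = grad F x - grad G x"
  by (intro grad_eqI GDERIV_diff GDERIV_grad assms)

lemma twice_differentiable_add:
  assumes "twice_differentiable F" "twice_differentiable G"
  shows "twice_differentiable (\<lambda>z. F z + G z)"
proof -
  have "grad (\<lambda>z. F z + G z) = (\<lambda>x. grad F x + grad G x)"
    using assms by (auto simp: twice_differentiable_def grad_add)
  then show ?thesis
    using assms by (auto simp: twice_differentiable_def)
qed

lemma twice_differentiable_divide:
  assumes "twice_differentiable F"
  shows "twice_differentiable (\<lambda>z. F z / c)"
proof -
  have "GDERIV (\<lambda>z. F z / c) x :> (1 / c) *\<^sub>R grad F x" for x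
  proof -
    have "((\<lambda>z. F z / c) has_derivative (\<lambda>v. (v \<bullet> grad F x) / c)) (at x)"
      using has_derivative_mult_left[of F "\<lambda>v. v \<bullet> grad F x" "at x" "1 / c"] GDERIV_grad[of F x] assms
      unfolding gderiv_def twice_differentiable_def by simp
    then show ?thesis by (simp add: gderiv_def)
  qed
  then have "grad (\<lambda>z. F z / c) = (\<lambda>x. (1 / c) *\<^sub>R grad F x)"
    using grad_eqI by blast
  then show ?thesis
    using assms unfolding twice_differentiable_def by (auto simp: divide_inverse)
qed

lemma twice_differentiable_sum:
  fixes F :: "'i \<Rightarrow> 'a::euclidean_space \<Rightarrow> real"
  assumes "finite I" "\<And>i. i \<in> I \<Longrightarrow> twice_differentiable (F i)"
  shows "twice_differentiable (\<lambda>z. \<Sum>i\<in>I. F i z)"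
  using assms
proof (induction I rule: finite_induct)
  case empty
  have "GDERIV (\<lambda>z::'a. 0 :: real) x :> 0" for x by (rule GDERIV_const)
  then have "grad (\<lambda>z::'a. 0 :: real) = (\<lambda>x. 0)" using grad_eqI by blast
  then show ?case by (simp add: twice_differentiable_def)
next
  case (insert i I)
  then show ?case by (simp add: twice_differentiable_add)
qed

lemma grad_borel_measurable:
  assumes "twice_differentiable F"
  shows "grad F \<in> borel_measurable borel"
  using assms unfolding twice_differentiable_def
  by (intro borel_measurable_continuous_onI differentiable_imp_continuous_on)
    (simp add: differentiable_on_def)

text \<open>
  The difference of the two Hessians is the derivative of the difference of the two gradients, so
  the mean value inequality turns the bound on the former into a Lipschitz constant of the latter.
\<close>

lemma hessian_similar_grad_lipschitz:
  assumes "twice_differentiable F1" "twice_differentiable F" "hessian_similar \<delta> F1 F"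
  shows "norm ((grad F x - grad F1 x) - (grad F y - grad F1 y)) \<le> \<delta> * norm (x - y)"
proof -
  have "norm ((grad F1 x - grad F x) - (grad F1 y - grad F y)) \<le> \<delta> * norm (x - y)"
  proof (rule differentiable_bound[where S = UNIV and f' = "\<lambda>z v. hess F1 z v - hess F z v"
        and f = "\<lambda>z. grad F1 z - grad F z"])
    fix z
    show "((\<lambda>z. grad F1 z - grad F z) has_derivative (\<lambda>v. hess F1 z v - hess F z v)) (at z within UNIV)"
      using assms unfolding hess_def twice_differentiable_def
      by (intro has_derivative_diff) (auto simp: frechet_derivative_works)
    show "onorm (\<lambda>v. hess F1 z v - hess F z v) \<le> \<delta>"
      using assms by (simp add: hessian_similar_def)
  qed auto
  then show ?thesis
    by (metis (no_types, lifting) minus_diff_eq minus_diff_minus norm_minus_cancel)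
qed


section \<open>Strongly convex functions\<close>

lemma strongly_convex_grad_monotone:
  fixes F :: "'a::euclidean_space \<Rightarrow> real"
  assumes "strongly_convex m F"
  shows "(grad F x - grad F y) \<bullet> (x - y) \<ge> m * (norm (x - y))\<^sup>2"
proof -
  have "F x \<ge> F y + grad F y \<bullet> (x - y) + m / 2 * (norm (x - y))\<^sup>2"
    "F y \<ge> F x + grad F x \<bullet> (y - x) + m / 2 * (norm (y - x))\<^sup>2"
    using assms unfolding strongly_convex_def by blast+
  then show ?thesis
    by (simp add: norm_minus_commute inner_diff_left inner_diff_right)
qed

text \<open>
  Along a segment the difference between \<open>F\<close> and its quadratic lower bound has a nonnegative
  derivative.
\<close>

lemma strongly_convex_if_grad_monotone:
  fixes F :: "'a::euclidean_space \<Rightarrow> real"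
  assumes diff: "\<And>x. F differentiable (at x)"
    and mono: "\<And>x y. (grad F x - grad F y) \<bullet> (x - y) \<ge> m * (norm (x - y))\<^sup>2"
  shows "strongly_convex m F"
  unfolding strongly_convex_def
proof (intro allI)
  fix x y :: 'a
  define v where "v = x - y"
  define \<phi> where "\<phi> t = F (y + t *\<^sub>R v) - t * (grad F y \<bullet> v) - m / 2 * t\<^sup>2 * (norm v)\<^sup>2" for t
  define \<phi>' where "\<phi>' t = v \<bullet> grad F (y + t *\<^sub>R v) - grad F y \<bullet> v - m * t * (norm v)\<^sup>2" for t
  have deriv: "(\<phi> has_real_derivative \<phi>' t) (at t)" for t
  proof -
    have line: "((\<lambda>t. y + t *\<^sub>R v) has_derivative (\<lambda>s. s *\<^sub>R v)) (at t)"
      by (auto intro!: derivative_eq_intros)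
    have "((\<lambda>t. F (y + t *\<^sub>R v)) has_derivative (\<lambda>s. (s *\<^sub>R v) \<bullet> grad F (y + t *\<^sub>R v))) (at t)"
      using has_derivative_compose[OF line] GDERIV_grad[OF diff] unfolding gderiv_def by blast
    then have "((\<lambda>t. F (y + t *\<^sub>R v)) has_real_derivative (v \<bullet> grad F (y + t *\<^sub>R v))) (at t)"
      unfolding has_field_derivative_def by (simp add: mult_commute_abs)
    then show ?thesis
      unfolding \<phi>_def \<phi>'_def by (auto intro!: derivative_eq_intros)
  qed
  have nonneg: "\<phi>' t \<ge> 0" if "0 < t" for t
  proof -
    have "m * (norm (t *\<^sub>R v))\<^sup>2 \<le> (grad F (y + t *\<^sub>R v) - grad F y) \<bullet> (t *\<^sub>R v)"
      using mono[of "y + t *\<^sub>R v" y] by simp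
    then have "t * (m * t * (norm v)\<^sup>2) \<le> t * ((grad F (y + t *\<^sub>R v) - grad F y) \<bullet> v)"
      by (simp add: power_mult_distrib power2_eq_square mult_ac)
    then have "m * t * (norm v)\<^sup>2 \<le> (grad F (y + t *\<^sub>R v) - grad F y) \<bullet> v"
      using that by simp
    then show ?thesis
      by (simp add: \<phi>'_def inner_diff_left inner_commute[of v])
  qed
  obtain t where "0 < t" "t < 1" "\<phi> 1 - \<phi> 0 = (1 - 0) * \<phi>' t"
    using MVT2[of 0 1 \<phi> \<phi>'] deriv by auto
  then have "\<phi> 1 \<ge> \<phi> 0" using nonneg[of t] by simp
  then show "F x \<ge> F y + grad F y \<bullet> (x - y) + m / 2 * (norm (x - y))\<^sup>2"
    by (simp add: \<phi>_def v_def)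
qed

text \<open>
  The quadratic lower bound keeps a sublevel set inside a ball, so the minimum over that ball is
  global.
\<close>

lemma strongly_convex_minimizer:
  fixes F :: "'a::euclidean_space \<Rightarrow> real"
  assumes "0 < m" "strongly_convex m F" and diff: "\<And>x. F differentiable (at x)"
  shows "F (minimizer F) \<le> F x"
    and "grad F (minimizer F) = 0"
proof -
  \<comment> \<open>outside this ball the quadratic term of the lower bound at \<open>0\<close> dominates the linear one\<close>
  let ?r = "2 * norm (grad F 0) / m"
  have "compact (cball (0::'a) ?r)" "cball (0::'a) ?r \<noteq> {}" "continuous_on (cball 0 ?r) F"
    using assms(1) diff
    by (auto simp: not_less intro!: divide_nonneg_nonneg differentiable_imp_continuous_on
        simp: differentiable_on_def differentiable_at_withinI)
  then obtain z where z: "z \<in> cball 0 ?r" "\<And>y. y \<in> cball 0 ?r \<Longrightarrow> F z \<le> F y"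
    using continuous_attains_inf[of "cball 0 ?r" F] by blast
  have "F z \<le> F y" for y
  proof (cases "y \<in> cball 0 ?r")
    case False
    then have "?r < norm y" by simp
    then have *: "norm (grad F 0) \<le> m / 2 * norm y"
      using \<open>0 < m\<close> by (simp add: field_simps)
    have "- (grad F 0 \<bullet> y) \<le> norm (grad F 0) * norm y"
      using norm_cauchy_schwarz[of "grad F 0" "- y"] by simp
    also have "\<dots> \<le> m / 2 * (norm y)\<^sup>2"
      using mult_right_mono[OF * norm_ge_zero[of y]] by (simp add: power2_eq_square)
    finally have "F 0 \<le> F y"
      using assms(2) unfolding strongly_convex_def by (smt (verit) diff_zero)
    then show ?thesis using z(2)[of 0] \<open>0 < m\<close> by (smt (verit) divide_nonneg_nonneg norm_ge_zero mem_cball dist_self)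
  qed (use z in auto)
  then have "is_arg_min F (\<lambda>_. True) z"
    by (simp add: is_arg_min_linorder)
  then have "is_arg_min F (\<lambda>_. True) (minimizer F)"
    unfolding minimizer_def arg_min_def by (rule someI)
  then show min: "F (minimizer F) \<le> F x" for x
    by (simp add: is_arg_min_linorder)
  have "(\<lambda>v. v \<bullet> grad F (minimizer F)) = (\<lambda>v. 0)"
    using GDERIV_grad[OF diff] min unfolding gderiv_def
    by (intro differential_zero_maxmin[of "minimizer F" UNIV F]) auto
  then show "grad F (minimizer F) = 0"
    by (metis inner_eq_zero_iff)
qed

text \<open>
  A small gradient certifies closeness to the minimizer.  This converts the residual with which a
  subproblem is solved into a distance.
\<close>

lemma strongly_convex_dist_minimizer:
  fixes F :: "'a::euclidean_space \<Rightarrow> real"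
  assumes "0 < m" "strongly_convex m F" "\<And>x. F differentiable (at x)"
  shows "m * norm (x - minimizer F) \<le> norm (grad F x)"
proof (cases "x = minimizer F")
  case False
  have "m * (norm (x - minimizer F))\<^sup>2 \<le> grad F x \<bullet> (x - minimizer F)"
    using strongly_convex_grad_monotone[OF assms(2), of x "minimizer F"]
      strongly_convex_minimizer(2)[OF assms] by simp
  also have "\<dots> \<le> norm (grad F x) * norm (x - minimizer F)"
    by (rule norm_cauchy_schwarz)
  finally show ?thesis
    using False by (simp add: power2_eq_square)
qed simp


section \<open>Square integrable vectors and fresh Boolean choices\<close>

text \<open>
  Square integrability is tracked for every quantity of a run, because the accuracy condition on
  the subproblems compares two possibly infinite integrals and says something only once both are
  known to be finite.
\<close>

definition square_integrable :: "'w measure \<Rightarrow> ('w \<Rightarrow> 'a::euclidean_space) \<Rightarrow> bool" where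
  "square_integrable M X \<longleftrightarrow>
     X \<in> borel_measurable M \<and> integrable M (\<lambda>\<omega>. (norm (X \<omega>))\<^sup>2)"

lemma square_integrableD:
  assumes "square_integrable M X"
  shows "X \<in> borel_measurable M" "integrable M (\<lambda>\<omega>. (norm (X \<omega>))\<^sup>2)"
  using assms by (auto simp: square_integrable_def)

lemma square_integrable_bound:
  assumes "X \<in> borel_measurable M" "integrable M B" "AE \<omega> in M. (norm (X \<omega>))\<^sup>2 \<le> B \<omega>"
  shows "square_integrable M X"
  unfolding square_integrable_def
proof
  show "integrable M (\<lambda>\<omega>. (norm (X \<omega>))\<^sup>2)"
    by (rule Bochner_Integration.integrable_bound[OF assms(2)]) (use assms in auto)
qed (fact assms)

lemma square_integrable_scaleR:
  assumes "square_integrable M X"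
  shows "square_integrable M (\<lambda>\<omega>. c *\<^sub>R X \<omega>)"
  using assms
  by (auto simp: square_integrable_def power_mult_distrib intro: borel_measurable_const_scaleR)

lemma square_integrable_norm:
  "square_integrable M X \<Longrightarrow> square_integrable M (\<lambda>\<omega>. norm (X \<omega>))"
  by (auto simp: square_integrable_def)

lemma square_integrable_lipschitz:
  assumes "Y \<in> borel_measurable M" "square_integrable M X"
    and "\<And>\<omega>. \<omega> \<in> space M \<Longrightarrow> norm (Y \<omega>) \<le> c * norm (X \<omega>)"
  shows "square_integrable M Y"
proof (rule square_integrable_bound[where B = "\<lambda>\<omega>. c\<^sup>2 * (norm (X \<omega>))\<^sup>2"])
  show "AE \<omega> in M. (norm (Y \<omega>))\<^sup>2 \<le> c\<^sup>2 * (norm (X \<omega>))\<^sup>2"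
    using power_mono[OF assms(3) norm_ge_zero, where n = 2] by (simp add: power_mult_distrib)
qed (use assms in \<open>auto simp: square_integrable_def\<close>)

lemma square_integrable_add:
  assumes "square_integrable M X" "square_integrable M Y"
  shows "square_integrable M (\<lambda>\<omega>. X \<omega> + Y \<omega>)"
proof (rule square_integrable_bound[where B = "\<lambda>\<omega>. 2 * (norm (X \<omega>))\<^sup>2 + 2 * (norm (Y \<omega>))\<^sup>2"])
  have "(norm (x + y))\<^sup>2 \<le> 2 * (norm x)\<^sup>2 + 2 * (norm y)\<^sup>2" for x y :: 'b
    using zero_le_power2[of "norm (x - y)"]
    by (simp add: power2_norm_eq_inner inner_add inner_diff inner_commute)
  then show "AE \<omega> in M. (norm (X \<omega> + Y \<omega>))\<^sup>2 \<le> 2 * (norm (X \<omega>))\<^sup>2 + 2 * (norm (Y \<omega>))\<^sup>2"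
    by simp
qed (use assms in \<open>auto simp: square_integrable_def\<close>)

lemma square_integrable_diff:
  assumes "square_integrable M X" "square_integrable M Y"
  shows "square_integrable M (\<lambda>\<omega>. X \<omega> - Y \<omega>)"
  using square_integrable_add[OF assms(1) square_integrable_scaleR[OF assms(2), of "-1"]] by simp

lemmas square_integrable_intros =
  square_integrable_add square_integrable_diff square_integrable_scaleR

lemma integrable_inner_square_integrable:
  assumes "square_integrable M X" "square_integrable M Y"
  shows "integrable M (\<lambda>\<omega>. X \<omega> \<bullet> Y \<omega>)"
proof (rule Bochner_Integration.integrable_bound)
  show "integrable M (\<lambda>\<omega>. (norm (X \<omega>))\<^sup>2 + (norm (Y \<omega>))\<^sup>2)"
    using assms by (simp add: square_integrable_def)
  have "\<bar>x \<bullet> y\<bar> \<le> (norm x)\<^sup>2 + (norm y)\<^sup>2" for x y :: 'b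
  proof -
    have "\<bar>x \<bullet> y\<bar> \<le> norm x * norm y" by (rule Cauchy_Schwarz_ineq2)
    also have "\<dots> \<le> (norm x)\<^sup>2 + (norm y)\<^sup>2"
      using sum_squares_bound[of "norm x" "norm y"] zero_le_power2[of "norm x"]
        zero_le_power2[of "norm y"] by linarith
    finally show ?thesis .
  qed
  then show "AE \<omega> in M. norm (X \<omega> \<bullet> Y \<omega>) \<le> norm ((norm (X \<omega>))\<^sup>2 + (norm (Y \<omega>))\<^sup>2)"
    by simp
qed (use assms in \<open>auto simp: square_integrable_def intro: borel_measurable_inner\<close>)

lemma nn_integral_norm_square:
  assumes "square_integrable M X"
  shows "(\<integral>\<^sup>+\<omega>. ennreal ((norm (X \<omega>))\<^sup>2) \<partial>M) = ennreal (\<integral>\<omega>. (norm (X \<omega>))\<^sup>2 \<partial>M)"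
  using assms by (intro nn_integral_eq_integral) (auto simp: square_integrable_def)

lemma fresh_choice_expectation:
  fixes \<phi> :: "bool \<Rightarrow> real"
  assumes "fresh_choice M F p b" "0 \<le> p" "p \<le> 1" "b \<in> measurable M (count_space UNIV)"
  shows "(\<integral>\<omega>. \<phi> (b \<omega>) \<partial>M) = p * \<phi> True + (1 - p) * \<phi> False"
proof -
  have "(\<integral>\<omega>. \<phi> (b \<omega>) \<partial>M) = (\<integral>x. \<phi> x \<partial>distr M (count_space UNIV) b)"
    using assms(4) by (subst integral_distr) auto
  also have "\<dots> = measure_pmf.expectation (bernoulli_pmf p) \<phi>"
    using assms(1) by (simp only: fresh_choice_def)
  also have "\<dots> = p * \<phi> True + (1 - p) * \<phi> False"
    using assms(2,3) by simp
  finally show ?thesis .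
qed

text \<open>
  Integrating out a choice that is independent of \<open>F\<close>: this is how the expectation over the random
  choice alone enters the expectation over the whole run.
\<close>

lemma fresh_choice_integral:
  fixes u v :: "'w \<Rightarrow> real"
  assumes "prob_space M" "subalgebra M F" and fresh: "fresh_choice M F p b"
    and p: "0 \<le> p" "p \<le> 1" and b[measurable]: "b \<in> measurable M (count_space UNIV)"
    and u: "u \<in> borel_measurable F" "integrable M u"
    and v: "v \<in> borel_measurable F" "integrable M v"
  shows "integrable M (\<lambda>\<omega>. if b \<omega> then u \<omega> else v \<omega>)"
    and "(\<integral>\<omega>. (if b \<omega> then u \<omega> else v \<omega>) \<partial>M) = (\<integral>\<omega>. p * u \<omega> + (1 - p) * v \<omega> \<partial>M)"
proof -
  interpret prob_space M by fact
  let ?B = "\<lambda>c \<omega>. of_bool (b \<omega> = c) :: real"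
  have B[measurable]: "?B c \<in> borel_measurable M" for c
    by measurable
  have B_prob: "expectation (?B c) = p * of_bool c + (1 - p) * of_bool (\<not> c)" for c
    using fresh_choice_expectation[OF fresh p b, of "\<lambda>x. of_bool (x = c)"] by (cases c) simp_all
  have *: "integrable M (\<lambda>\<omega>. w \<omega> * ?B c \<omega>) \<and>
      expectation (\<lambda>\<omega>. w \<omega> * ?B c \<omega>) = expectation w * (p * of_bool c + (1 - p) * of_bool (\<not> c))"
    if w: "w \<in> borel_measurable F" "integrable M w" for w c
  proof -
    have w_pre: "w -` A \<inter> space M \<in> sets F" if "A \<in> sets borel" for A
      using measurable_sets[OF w(1) that] \<open>subalgebra M F\<close> by (simp add: subalgebra_def)
    have B_pre: "?B c -` A \<inter> space M \<in> sets (vimage_algebra (space M) b (count_space UNIV))" for A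
    proof -
      have "?B c -` A \<inter> space M = b -` {x. of_bool (x = c) \<in> A} \<inter> space M" by blast
      then show ?thesis by (metis in_vimage_algebra UNIV_I sets_count_space Pow_UNIV)
    qed
    have ind: "indep_var borel w borel (?B c)"
      unfolding indep_var_eq
    proof (intro conjI indep_set_sigma_sets)
      have ind: "indep_set (sets F) (sets (vimage_algebra (space M) b (count_space UNIV)))"
        using fresh by (simp add: fresh_choice_def)
      show "indep_set {w -` A \<inter> space M |A. A \<in> sets borel} {?B c -` A \<inter> space M |A. A \<in> sets borel}"
        using w_pre B_pre indep_setD_ev1[OF ind] indep_setD_ev2[OF ind]
        by (intro indep_setI) (auto intro!: indep_setD[OF ind])
      have "Int_stable {X -` A \<inter> space M |A. A \<in> sets borel}" for X :: "'w \<Rightarrow> real"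
      proof (safe intro!: Int_stableI)
        fix A B :: "real set" assume "A \<in> sets borel" "B \<in> sets borel"
        then show "\<exists>C. X -` A \<inter> space M \<inter> (X -` B \<inter> space M) = X -` C \<inter> space M \<and> C \<in> sets borel"
          by (intro exI[of _ "A \<inter> B"]) auto
      qed
      then show "Int_stable {w -` A \<inter> space M |A. A \<in> sets borel}"
        "Int_stable {?B c -` A \<inter> space M |A. A \<in> sets borel}" by blast+
    qed (use w in auto)
    have "integrable M (?B c)"
      by (rule integrable_const_bound[of _ 1]) auto
    then show ?thesis
      using indep_var_integrable[OF ind w(2)] indep_var_lebesgue_integral[OF ind w(2)] B_prob
      by simp
  qed
  have eq: "(if b \<omega> then u \<omega> else v \<omega>) = u \<omega> * ?B True \<omega> + v \<omega> * ?B False \<omega>" for \<omega>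
    by simp
  show "integrable M (\<lambda>\<omega>. if b \<omega> then u \<omega> else v \<omega>)"
    unfolding eq using *[OF u, of True] *[OF v, of False] by simp
  show "(\<integral>\<omega>. (if b \<omega> then u \<omega> else v \<omega>) \<partial>M) = (\<integral>\<omega>. p * u \<omega> + (1 - p) * v \<omega> \<partial>M)"
    unfolding eq using *[OF u, of True] *[OF v, of False] u v p by (simp add: mult.commute)
qed

text \<open>
  The noise \<open>n c z\<close> depends on the choice \<open>c\<close> and the point \<open>z\<close> at which the oracle is called.  Both
  values of \<open>c\<close> have positive probability, so a bound on the second moment over the choice bounds
  each of \<open>n True Z\<close> and \<open>n False Z\<close> almost surely.  An unbiased noise is orthogonal to everything
  that is determined before the choice.
\<close>

lemma fresh_choice_noise:
  fixes n :: "bool \<Rightarrow> 'b::topological_space \<Rightarrow> 'a::euclidean_space" and s :: real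
  assumes M: "prob_space M" "subalgebra M F" "fresh_choice M F p b"
    and p: "0 < p" "p < 1" and b[measurable]: "b \<in> measurable M (count_space UNIV)"
    and n: "\<And>c. n c \<in> borel_measurable borel" and Z: "Z \<in> borel_measurable F"
    and var: "AE \<omega> in M. p * (norm (n True (Z \<omega>)))\<^sup>2 + (1 - p) * (norm (n False (Z \<omega>)))\<^sup>2 \<le> s"
  shows "square_integrable M (\<lambda>\<omega>. n (b \<omega>) (Z \<omega>))"
    and "(\<integral>\<omega>. (norm (n (b \<omega>) (Z \<omega>)))\<^sup>2 \<partial>M) \<le> s"
    and "\<lbrakk>\<And>z. p *\<^sub>R n True z + (1 - p) *\<^sub>R n False z = 0;
          Y \<in> borel_measurable F; square_integrable M Y\<rbrakk>
         \<Longrightarrow> (\<integral>\<omega>. n (b \<omega>) (Z \<omega>) \<bullet> Y \<omega> \<partial>M) = 0"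
proof -
  interpret prob_space M by fact
  have nZ: "(\<lambda>\<omega>. n c (Z \<omega>)) \<in> borel_measurable F" for c
    using measurable_compose[OF Z n] .
  note nZ_M[measurable] = measurable_from_subalg[OF M(2) nZ]
  have sq: "square_integrable M (\<lambda>\<omega>. n c (Z \<omega>))" for c
  proof (rule square_integrable_bound[where B = "\<lambda>_. s / (if c then p else 1 - p)"])
    show "AE \<omega> in M. (norm (n c (Z \<omega>)))\<^sup>2 \<le> s / (if c then p else 1 - p)"
      using var
    proof eventually_elim
      case (elim \<omega>)
      have "0 \<le> p * (norm (n True (Z \<omega>)))\<^sup>2" "0 \<le> (1 - p) * (norm (n False (Z \<omega>)))\<^sup>2"
        using p by simp_all
      with elim have "(norm (n c (Z \<omega>)))\<^sup>2 * (if c then p else 1 - p) \<le> s"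
        by (cases c) (simp_all add: mult.commute)
      then show ?case
        using p by (cases c) (simp_all add: pos_le_divide_eq)
    qed
  qed simp_all
  have eq: "(norm (n (b \<omega>) (Z \<omega>)))\<^sup>2
      = (if b \<omega> then (norm (n True (Z \<omega>)))\<^sup>2 else (norm (n False (Z \<omega>)))\<^sup>2)" for \<omega>
    by (cases "b \<omega>") simp_all
  have p': "0 \<le> p" "p \<le> 1" using p by simp_all
  have nZ2: "(\<lambda>\<omega>. (norm (n c (Z \<omega>)))\<^sup>2) \<in> borel_measurable F" for c
    using nZ[of c] by simp
  note int = fresh_choice_integral[OF M p' b nZ2 square_integrableD(2)[OF sq]
      nZ2 square_integrableD(2)[OF sq], of True False, folded eq]
  have "n (b \<omega>) (Z \<omega>) = (if b \<omega> then n True (Z \<omega>) else n False (Z \<omega>))" for \<omega>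
    by (cases "b \<omega>") simp_all
  then have "(\<lambda>\<omega>. n (b \<omega>) (Z \<omega>)) = (\<lambda>\<omega>. if b \<omega> then n True (Z \<omega>) else n False (Z \<omega>))"
    by (rule ext)
  then have meas: "(\<lambda>\<omega>. n (b \<omega>) (Z \<omega>)) \<in> borel_measurable M"
    by simp
  then show "square_integrable M (\<lambda>\<omega>. n (b \<omega>) (Z \<omega>))"
    using int(1) by (simp add: square_integrable_def)
  have "(\<integral>\<omega>. (norm (n (b \<omega>) (Z \<omega>)))\<^sup>2 \<partial>M)
      = (\<integral>\<omega>. p * (norm (n True (Z \<omega>)))\<^sup>2 + (1 - p) * (norm (n False (Z \<omega>)))\<^sup>2 \<partial>M)"
    by (rule int(2))
  also have "\<dots> \<le> (\<integral>\<omega>. s \<partial>M)"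
    using var square_integrableD(2)[OF sq] by (intro integral_mono_AE) auto
  finally show "(\<integral>\<omega>. (norm (n (b \<omega>) (Z \<omega>)))\<^sup>2 \<partial>M) \<le> s"
    by (simp add: prob_space)
  assume zero: "\<And>z. p *\<^sub>R n True z + (1 - p) *\<^sub>R n False z = 0"
    and Y: "Y \<in> borel_measurable F" "square_integrable M Y"
  have nY: "(\<lambda>\<omega>. n c (Z \<omega>) \<bullet> Y \<omega>) \<in> borel_measurable F" for c
    using nZ[of c] Y(1) by (rule borel_measurable_inner)
  have eq: "n (b \<omega>) (Z \<omega>) \<bullet> Y \<omega> = (if b \<omega> then n True (Z \<omega>) \<bullet> Y \<omega> else n False (Z \<omega>) \<bullet> Y \<omega>)" for \<omega>
    by (cases "b \<omega>") simp_all
  have "(\<integral>\<omega>. n (b \<omega>) (Z \<omega>) \<bullet> Y \<omega> \<partial>M)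
      = (\<integral>\<omega>. p * (n True (Z \<omega>) \<bullet> Y \<omega>) + (1 - p) * (n False (Z \<omega>) \<bullet> Y \<omega>) \<partial>M)"
    unfolding eq
    by (rule fresh_choice_integral(2)[OF M p' b nY integrable_inner_square_integrable[OF sq Y(2)]
          nY integrable_inner_square_integrable[OF sq Y(2)]])
  also have "\<dots> = (\<integral>\<omega>. (p *\<^sub>R n True (Z \<omega>) + (1 - p) *\<^sub>R n False (Z \<omega>)) \<bullet> Y \<omega> \<partial>M)"
    by (simp only: inner_add_left inner_scaleR_left)
  also have "\<dots> = 0"
    by (simp add: zero)
  finally show "(\<integral>\<omega>. n (b \<omega>) (Z \<omega>) \<bullet> Y \<omega> \<partial>M) = 0" .
qed


section \<open>One iteration, pointwise\<close>

text \<open>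
  This is \<open>(a\<^sub>1 + a\<^sub>2 + a\<^sub>3)\<^sup>2 \<le> a\<^sub>1\<^sup>2 / w\<^sub>1 + a\<^sub>2\<^sup>2 / w\<^sub>2 + a\<^sub>3\<^sup>2 / w\<^sub>3\<close> with the weights \<open>3 / 10\<close>, \<open>1 / 2\<close> and \<open>1 / 5\<close>,
  which add up to \<open>1\<close> and fit the accuracy \<open>1 / 11\<close> of the subproblems.
\<close>

lemma sum3_square_le:
  fixes a b c :: real
  shows "(a / 3 + b + c)\<^sup>2 \<le> 10 / 27 * a\<^sup>2 + 2 * b\<^sup>2 + 5 * c\<^sup>2"
proof -
  have "10 / 27 * a\<^sup>2 + 2 * b\<^sup>2 + 5 * c\<^sup>2 - (a / 3 + b + c)\<^sup>2
      = 3 / 20 * (10 / 9 * a - 2 * b)\<^sup>2 + 3 / 50 * (10 / 9 * a - 5 * c)\<^sup>2 + 1 / 10 * (2 * b - 5 * c)\<^sup>2"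
    by (simp add: power2_eq_square field_simps)
  also have "\<dots> \<ge> 0"
    by (intro add_nonneg_nonneg mult_nonneg_nonneg) simp_all
  finally show ?thesis by simp
qed

locale similar_problem =
  fixes P :: "'a::euclidean_space problem" and \<mu> \<delta>f \<delta>g :: real
  assumes mu_pos: "0 < \<mu>"
    and delta: "\<mu> < \<delta>f" "\<delta>f < \<delta>g"
    and problem: "composite_problem P"
    and convex: "strongly_convex \<mu> (obj_h P)"
    and similar_f: "hessian_similar \<delta>f (server_f P) (obj_f P)"
    and similar_g: "hessian_similar \<delta>g (server_g P) (obj_g P)"
begin

abbreviation "h \<equiv> obj_h P"
abbreviation "h1 \<equiv> server_h P"
abbreviation "xs \<equiv> minimizer (obj_h P)"
abbreviation "dq \<equiv> grad (\<lambda>z. obj_h P z - server_h P z)"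

lemma twice_differentiable_parts:
  "twice_differentiable (obj_f P)" "twice_differentiable (obj_g P)"
  "twice_differentiable (server_f P)" "twice_differentiable (server_g P)"
proof -
  have "obj_f P = (\<lambda>x. (\<Sum>m\<in>nodes_f P. loss_f P m x) / real (card (nodes_f P)))"
    "obj_g P = (\<lambda>x. (\<Sum>m\<in>nodes_g P. loss_g P m x) / real (card (nodes_g P)))"
    by (auto simp: obj_f_def obj_g_def)
  then show "twice_differentiable (obj_f P)" "twice_differentiable (obj_g P)"
    using problem unfolding composite_problem_def
    by (auto intro!: twice_differentiable_divide twice_differentiable_sum)
  show "twice_differentiable (server_f P)" "twice_differentiable (server_g P)"
    using problem by (auto simp: composite_problem_def server_f_def server_g_def)
qed

lemma twice_differentiable_sums: "twice_differentiable h" "twice_differentiable h1"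
proof -
  have "h = (\<lambda>x. obj_f P x + obj_g P x)" "h1 = (\<lambda>x. server_f P x + server_g P x)"
    by (auto simp: obj_h_def server_h_def)
  then show "twice_differentiable h" "twice_differentiable h1"
    using twice_differentiable_parts by (simp_all add: twice_differentiable_add)
qed

lemma differentiable:
  "obj_f P differentiable (at x)" "obj_g P differentiable (at x)"
  "server_f P differentiable (at x)" "server_g P differentiable (at x)"
  "h differentiable (at x)" "h1 differentiable (at x)"
  using twice_differentiable_parts twice_differentiable_sums
  by (auto simp: twice_differentiable_def)

lemma grad_h: "grad h x = grad (obj_f P) x + grad (obj_g P) x"
proof -
  have "h = (\<lambda>x. obj_f P x + obj_g P x)" by (auto simp: obj_h_def)
  then show ?thesis using grad_add[OF differentiable(1,2)] by simp
qed

lemma grad_h1: "grad h1 x = grad (server_f P) x + grad (server_g P) x"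
proof -
  have "h1 = (\<lambda>x. server_f P x + server_g P x)" by (auto simp: server_h_def)
  then show ?thesis using grad_add[OF differentiable(3,4)] by simp
qed

lemma dq_eq: "dq x = grad h x - grad h1 x"
  by (rule grad_diff) (rule differentiable)+

lemma dq_lipschitz: "norm (dq x - dq y) \<le> (\<delta>f + \<delta>g) * norm (x - y)"
proof -
  have "dq x - dq y =
      ((grad (obj_f P) x - grad (server_f P) x) - (grad (obj_f P) y - grad (server_f P) y)) +
      ((grad (obj_g P) x - grad (server_g P) x) - (grad (obj_g P) y - grad (server_g P) y))"
    by (simp add: dq_eq grad_h grad_h1)
  also have "norm \<dots> \<le> \<delta>f * norm (x - y) + \<delta>g * norm (x - y)"
    using twice_differentiable_parts similar_f similar_g
    by (intro norm_triangle_mono hessian_similar_grad_lipschitz)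
  finally show ?thesis by (simp add: distrib_right)
qed

lemma h_gap_nonneg: "0 \<le> h x - h xs"
  using strongly_convex_minimizer(1)[OF mu_pos convex differentiable(5)] by simp

lemma h_gap_quadratic: "\<mu> / 2 * (norm (x - xs))\<^sup>2 \<le> h x - h xs"
proof -
  have "h xs + grad h xs \<bullet> (x - xs) + \<mu> / 2 * (norm (x - xs))\<^sup>2 \<le> h x"
    using convex by (simp add: strongly_convex_def)
  then show ?thesis
    using strongly_convex_minimizer(2)[OF mu_pos convex differentiable(5)] by simp
qed

lemma grad_xs: "grad h xs = 0"
  by (rule strongly_convex_minimizer(2)[OF mu_pos convex differentiable(5)])

text \<open>
  The objective of the subproblem with oracle value \<open>\<xi>\<close> and prox centre \<open>u\<close>, detached from a run.
\<close>

definition model :: "'a \<Rightarrow> real \<Rightarrow> 'a \<Rightarrow> 'a \<Rightarrow> real" where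
  "model \<xi> \<theta> u x = \<xi> \<bullet> x + 1 / (2 * \<theta>) * (norm (x - u))\<^sup>2 + h1 x"

lemma GDERIV_model:
  assumes "0 < \<theta>"
  shows "GDERIV (model \<xi> \<theta> u) x :> \<xi> + (1 / \<theta>) *\<^sub>R (x - u) + grad h1 x"
proof -
  have "((\<lambda>x. \<xi> \<bullet> x + c * ((x - u) \<bullet> (x - u)) + h1 x) has_derivative
      (\<lambda>v. \<xi> \<bullet> v + c * ((x - u) \<bullet> v + v \<bullet> (x - u)) + v \<bullet> grad h1 x)) (at x)" for c
    using GDERIV_grad[OF differentiable(6)[of x]] unfolding gderiv_def
    by (auto intro!: derivative_eq_intros)
  from this[of "1 / (2 * \<theta>)"] show ?thesis
    using assms unfolding gderiv_def model_def power2_norm_eq_inner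
    by (rule_tac has_derivative_eq_rhs)
      (auto simp: inner_commute[of _ "x - u"] inner_commute[of _ \<xi>] inner_add_right)
qed

lemma grad_model: "0 < \<theta> \<Longrightarrow> grad (model \<xi> \<theta> u) x = \<xi> + (1 / \<theta>) *\<^sub>R (x - u) + grad h1 x"
  by (rule grad_eqI[OF GDERIV_model])

text \<open>
  The server objective \<open>h\<^sub>1 = h - (h - h\<^sub>1)\<close> may lose convexity of order at most \<open>\<delta>\<^sub>f + \<delta>\<^sub>g\<close>, which is a
  third of the curvature \<open>1 / \<theta>\<close> of the proximal term.
\<close>

lemma model_strongly_convex:
  assumes "0 < \<theta>" "\<theta> * (3 * (\<delta>f + \<delta>g)) \<le> 1"
  shows "strongly_convex (2 / (3 * \<theta>)) (model \<xi> \<theta> u)"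
proof (rule strongly_convex_if_grad_monotone)
  show "model \<xi> \<theta> u differentiable (at x)" for x
    by (rule differentiable_GDERIV[OF GDERIV_model[OF assms(1)]])
  fix x y :: 'a
  let ?d = "x - y"
  have L: "\<delta>f + \<delta>g \<le> 1 / (3 * \<theta>)"
    using assms by (simp add: field_simps)
  have "(dq x - dq y) \<bullet> ?d \<le> norm (dq x - dq y) * norm ?d"
    by (rule norm_cauchy_schwarz)
  also have "\<dots> \<le> (\<delta>f + \<delta>g) * norm ?d * norm ?d"
    by (intro mult_right_mono dq_lipschitz) simp
  also have "\<dots> \<le> 1 / (3 * \<theta>) * norm ?d * norm ?d"
    using L by (intro mult_right_mono) simp_all
  finally have q: "(dq x - dq y) \<bullet> ?d \<le> 1 / (3 * \<theta>) * (norm ?d)\<^sup>2"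
    by (simp add: power2_eq_square)
  have "0 \<le> \<mu> * (norm ?d)\<^sup>2" using mu_pos by simp
  also have "\<dots> \<le> (grad h x - grad h y) \<bullet> ?d"
    by (rule strongly_convex_grad_monotone[OF convex])
  finally have h: "0 \<le> (grad h x - grad h y) \<bullet> ?d" .
  have "grad (model \<xi> \<theta> u) x - grad (model \<xi> \<theta> u) y
      = (1 / \<theta>) *\<^sub>R ?d + (grad h x - grad h y) - (dq x - dq y)"
    using assms(1) by (simp add: grad_model dq_eq scaleR_diff_right)
  then have "(grad (model \<xi> \<theta> u) x - grad (model \<xi> \<theta> u) y) \<bullet> ?d
      = (1 / \<theta>) * (norm ?d)\<^sup>2 + (grad h x - grad h y) \<bullet> ?d - (dq x - dq y) \<bullet> ?d"
    by (simp add: inner_diff_left inner_add_left power2_norm_eq_inner)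
  moreover have "2 / (3 * \<theta>) * (norm ?d)\<^sup>2 = (1 / \<theta>) * (norm ?d)\<^sup>2 - 1 / (3 * \<theta>) * (norm ?d)\<^sup>2"
    using assms(1) by (simp add: field_simps)
  ultimately show "2 / (3 * \<theta>) * (norm ?d)\<^sup>2
      \<le> (grad (model \<xi> \<theta> u) x - grad (model \<xi> \<theta> u) y) \<bullet> ?d"
    using q h by linarith
qed

lemma model_minimizer_dist:
  assumes "0 < \<theta>" "\<theta> * (3 * (\<delta>f + \<delta>g)) \<le> 1"
  shows "norm (y - minimizer (model \<xi> \<theta> u)) \<le> 3 / 2 * \<theta> * norm (grad (model \<xi> \<theta> u) y)"
proof -
  have "2 / (3 * \<theta>) * norm (y - minimizer (model \<xi> \<theta> u)) \<le> norm (grad (model \<xi> \<theta> u) y)"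
    using assms model_strongly_convex[OF assms]
    by (intro strongly_convex_dist_minimizer differentiable_GDERIV[OF GDERIV_model]) simp_all
  then show ?thesis
    using assms(1) by (simp add: field_simps)
qed

text \<open>
  The constants \<open>9 / 5\<close> and \<open>81 / 16\<close> come from \<open>(a + b)\<^sup>2 \<le> (1 + c) a\<^sup>2 + (1 + 1 / c) b\<^sup>2\<close> with \<open>c = 4 / 5\<close>.
\<close>

lemma model_minimizer_dist_square:
  assumes "0 < \<theta>" "\<theta> * (3 * (\<delta>f + \<delta>g)) \<le> 1"
  shows "(norm (u - minimizer (model \<xi> \<theta> u)))\<^sup>2
    \<le> 9 / 5 * (norm (y - u))\<^sup>2 + 81 / 16 * \<theta>\<^sup>2 * (norm (grad (model \<xi> \<theta> u) y))\<^sup>2"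
proof -
  let ?a = "norm (y - u)" and ?b = "3 / 2 * \<theta> * norm (grad (model \<xi> \<theta> u) y)"
  have "norm (u - minimizer (model \<xi> \<theta> u)) \<le> norm (u - y) + norm (y - minimizer (model \<xi> \<theta> u))"
    using norm_triangle_ineq[of "u - y" "y - minimizer (model \<xi> \<theta> u)"] by simp
  also have "\<dots> \<le> ?a + ?b"
    using model_minimizer_dist[OF assms] by (simp add: norm_minus_commute)
  finally have "(norm (u - minimizer (model \<xi> \<theta> u)))\<^sup>2 \<le> (?a + ?b)\<^sup>2"
    by (intro power_mono) simp_all
  also have "\<dots> = 9 / 5 * ?a\<^sup>2 + 9 / 4 * ?b\<^sup>2 - (4 * ?a - 5 * ?b)\<^sup>2 / 20"
    by (simp add: power2_eq_square field_simps)
  also have "\<dots> \<le> 9 / 5 * ?a\<^sup>2 + 9 / 4 * ?b\<^sup>2"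
    by simp
  finally show ?thesis
    by (simp add: power_mult_distrib power2_eq_square[of "3::real"] power2_eq_square[of "2::real"] power_divide)
qed

text \<open>
  The gradient of \<open>h\<^sub>1\<close> may grow arbitrarily fast, but at \<open>x\<^sub>*\<close> it equals \<open>- \<nabla>(h - h\<^sub>1)\<close>.  The gradient of
  the model at \<open>x\<^sub>*\<close> is therefore controlled by the distance of the prox centre and the noise, both
  square integrable along a run.
\<close>

lemma model_minimizer_dist_xs:
  assumes "0 < \<theta>" "\<theta> * (3 * (\<delta>f + \<delta>g)) \<le> 1"
  shows "norm (minimizer (model \<xi> \<theta> u) - xs) \<le> 2 * norm (u - xs) + 3 / 2 * \<theta> * norm (\<xi> - dq u)"
proof -
  have "\<theta> *\<^sub>R grad (model \<xi> \<theta> u) xs = \<theta> *\<^sub>R (\<xi> - dq u) + \<theta> *\<^sub>R (dq u - dq xs) - (u - xs)"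
    using assms(1) by (simp add: grad_model dq_eq[of xs] grad_xs algebra_simps)
  also have "norm \<dots> \<le> norm (\<theta> *\<^sub>R (\<xi> - dq u) + \<theta> *\<^sub>R (dq u - dq xs)) + norm (u - xs)"
    by (rule norm_triangle_ineq4)
  also have "\<dots> \<le> norm (\<theta> *\<^sub>R (\<xi> - dq u)) + norm (\<theta> *\<^sub>R (dq u - dq xs)) + norm (u - xs)"
    by (intro add_right_mono norm_triangle_ineq)
  also have "\<dots> = \<theta> * norm (\<xi> - dq u) + \<theta> * norm (dq u - dq xs) + norm (u - xs)"
    using assms(1) by simp
  also have "\<theta> * norm (dq u - dq xs) \<le> \<theta> * ((\<delta>f + \<delta>g) * norm (u - xs))"
    using assms(1) by (intro mult_left_mono dq_lipschitz) simp
  also have "\<dots> \<le> 1 / 3 * norm (u - xs)"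
    unfolding mult.assoc[symmetric] using assms(2) by (intro mult_right_mono) (simp_all add: algebra_simps)
  finally have "\<theta> * norm (grad (model \<xi> \<theta> u) xs) \<le> \<theta> * norm (\<xi> - dq u) + 4 / 3 * norm (u - xs)"
    using assms(1) by simp
  then show ?thesis
    using model_minimizer_dist[OF assms, of xs \<xi> u] by (simp add: norm_minus_commute)
qed

text \<open>
  With \<open>w = \<nabla>h(y) + (y - u) / \<theta>\<close> the polarization identity gives
  \<open>2\<theta>\<langle>\<nabla>h(y), y - u\<rangle> = \<theta>\<^sup>2\<bar>w\<bar>\<^sup>2 - \<theta>\<^sup>2\<bar>\<nabla>h(y)\<bar>\<^sup>2 - \<bar>y - u\<bar>\<^sup>2\<close>.  The vector \<open>w\<close> consists of errors only: the
  change of the gradient of \<open>h - h\<^sub>1\<close> between \<open>u\<close> and \<open>y\<close>, the noise of the oracle and the residual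
  of the subproblem.
\<close>

lemma extragradient_descent:
  assumes "0 < \<theta>" "\<theta> * (3 * (\<delta>f + \<delta>g)) \<le> 1"
  shows "2 * \<theta> * (grad h y \<bullet> (y - u)) \<le> 2 * \<theta>\<^sup>2 * (norm (grad (model \<xi> \<theta> u) y))\<^sup>2
    - 17 / 27 * (norm (y - u))\<^sup>2 + 5 * \<theta>\<^sup>2 * (norm (\<xi> - dq u))\<^sup>2 - \<theta>\<^sup>2 * (norm (grad h y))\<^sup>2"
proof -
  let ?r = "grad (model \<xi> \<theta> u) y" and ?e = "\<xi> - dq u" and ?G = "grad h y" and ?D = "y - u"
  have w: "\<theta> *\<^sub>R ?G + ?D = \<theta> *\<^sub>R (dq y - dq u) + \<theta> *\<^sub>R ?r - \<theta> *\<^sub>R ?e"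
    using assms(1) by (simp add: grad_model dq_eq[of y] algebra_simps)
  have "norm (\<theta> *\<^sub>R ?G + ?D) \<le> norm (\<theta> *\<^sub>R (dq y - dq u)) + norm (\<theta> *\<^sub>R ?r) + norm (\<theta> *\<^sub>R ?e)"
    unfolding w by (intro order_trans[OF norm_triangle_ineq4] add_right_mono norm_triangle_ineq)
  also have "\<dots> = \<theta> * norm (dq y - dq u) + \<theta> * norm ?r + \<theta> * norm ?e"
    using assms(1) by simp
  also have "\<theta> * norm (dq y - dq u) \<le> \<theta> * ((\<delta>f + \<delta>g) * norm ?D)"
    using assms(1) by (intro mult_left_mono dq_lipschitz) simp
  also have "\<dots> \<le> 1 / 3 * norm ?D"
    unfolding mult.assoc[symmetric] using assms(2) by (intro mult_right_mono) (simp_all add: algebra_simps)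
  finally have "(norm (\<theta> *\<^sub>R ?G + ?D))\<^sup>2 \<le> (norm ?D / 3 + \<theta> * norm ?r + \<theta> * norm ?e)\<^sup>2"
    by (intro power_mono) simp_all
  also have "\<dots> \<le> 10 / 27 * (norm ?D)\<^sup>2 + 2 * (\<theta> * norm ?r)\<^sup>2 + 5 * (\<theta> * norm ?e)\<^sup>2"
    by (rule sum3_square_le)
  finally have "(norm (\<theta> *\<^sub>R ?G + ?D))\<^sup>2
      \<le> 10 / 27 * (norm ?D)\<^sup>2 + 2 * \<theta>\<^sup>2 * (norm ?r)\<^sup>2 + 5 * \<theta>\<^sup>2 * (norm ?e)\<^sup>2"
    by (simp add: power_mult_distrib)
  moreover have "(norm (\<theta> *\<^sub>R ?G + d))\<^sup>2 = \<theta>\<^sup>2 * (norm ?G)\<^sup>2 + 2 * \<theta> * (?G \<bullet> d) + (norm d)\<^sup>2"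
    for d
    unfolding power2_norm_eq_inner
    by (simp add: inner_add_left inner_add_right inner_commute[of d ?G] power2_eq_square algebra_simps)
  ultimately show ?thesis by simp
qed

text \<open>
  The noise-free part of the new iterate is \<open>x\<^sub>* + Y\<close>, and \<open>n\<close> is the noise of the gradient at \<open>y\<close>.
  Linear coupling: \<open>\<tau>(y - x) = (y - u) + (1 - \<tau>)(x\<^sub>b - y)\<close>, so a step from \<open>x\<close> towards \<open>y\<close> is paid for
  partly by the descent from \<open>u\<close> and partly by the decrease of the gap from \<open>x\<^sub>b\<close> to \<open>y\<close>.
\<close>

lemma coupling_step:
  fixes x xb y u n :: 'a
  assumes tau: "0 < \<tau>" "\<tau> < 1" and u: "u = \<tau> *\<^sub>R x + (1 - \<tau>) *\<^sub>R xb"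
  defines "Y \<equiv> x - xs + (\<tau> / 2) *\<^sub>R (y - x) - (\<tau> / (2 * \<mu>)) *\<^sub>R grad h y"
  shows "\<mu> * (norm (Y - (\<tau> / (2 * \<mu>)) *\<^sub>R n))\<^sup>2
    \<le> \<mu> * (1 - \<tau> / 2) * (norm (x - xs))\<^sup>2 - \<tau> * (h y - h xs)
      + (1 - \<tau> / 2) * (grad h y \<bullet> (y - u) + (1 - \<tau>) * ((h xb - h xs) - (h y - h xs)))
      + \<tau>\<^sup>2 / (4 * \<mu>) * (norm (grad h y))\<^sup>2 - \<tau> * (n \<bullet> Y) + \<tau>\<^sup>2 / (4 * \<mu>) * (norm n)\<^sup>2"
proof -
  let ?G = "grad h y"
  define s where "s = \<tau> / 2"
  define Z where "Z = (1 - s) *\<^sub>R (x - xs) + s *\<^sub>R (y - xs)"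
  have Y: "Y = Z - (\<tau> / (2 * \<mu>)) *\<^sub>R ?G"
    by (simp add: Y_def Z_def s_def algebra_simps)
  have scale: "\<mu> * (norm (a - (\<tau> / (2 * \<mu>)) *\<^sub>R c))\<^sup>2
      = \<mu> * (norm a)\<^sup>2 - \<tau> * (c \<bullet> a) + \<tau>\<^sup>2 / (4 * \<mu>) * (norm c)\<^sup>2" for a c :: 'a
    using mu_pos unfolding power2_norm_eq_inner
    by (simp add: inner_diff_left inner_diff_right inner_commute[of a c] field_simps power2_eq_square)
  have "(norm ((1 - s) *\<^sub>R a + s *\<^sub>R b))\<^sup>2
      = (1 - s) * (norm a)\<^sup>2 + s * (norm b)\<^sup>2 - s * (1 - s) * (norm (a - b))\<^sup>2" for a b :: 'a
    unfolding power2_norm_eq_inner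
    by (simp add: inner_add_left inner_add_right inner_diff_left inner_diff_right
        inner_commute[of b a] algebra_simps)
  moreover have "0 \<le> s * (1 - s) * (norm ((x - xs) - (y - xs)))\<^sup>2"
    using tau by (simp add: s_def)
  ultimately have "(norm Z)\<^sup>2 \<le> (1 - s) * (norm (x - xs))\<^sup>2 + s * (norm (y - xs))\<^sup>2"
    unfolding Z_def by (metis diff_le_eq le_add_same_cancel1)
  then have Z_le: "\<mu> * (norm Z)\<^sup>2 \<le> \<mu> * ((1 - s) * (norm (x - xs))\<^sup>2 + s * (norm (y - xs))\<^sup>2)"
    using mu_pos by (intro mult_left_mono) simp_all
  have coupling: "\<tau> *\<^sub>R Z = \<tau> *\<^sub>R (y - xs) - (1 - s) *\<^sub>R ((y - u) + (1 - \<tau>) *\<^sub>R (xb - y))"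
  proof -
    have step: "(y - u) + (1 - \<tau>) *\<^sub>R (xb - y) = \<tau> *\<^sub>R (y - x)"
      by (simp add: u algebra_simps)
    show ?thesis unfolding step by (simp add: Z_def algebra_simps)
  qed
  have GZ: "\<tau> * (?G \<bullet> Z)
      = \<tau> * (?G \<bullet> (y - xs)) - (1 - s) * (?G \<bullet> (y - u) + (1 - \<tau>) * (?G \<bullet> (xb - y)))"
    using arg_cong[OF coupling, of "\<lambda>v. ?G \<bullet> v"]
    by (simp only: inner_scaleR_right inner_diff_right[of ?G "\<tau> *\<^sub>R _"] inner_add_right)
  have "h y + ?G \<bullet> (xs - y) + \<mu> / 2 * (norm (xs - y))\<^sup>2 \<le> h xs"
    using convex by (simp add: strongly_convex_def)
  then have "\<tau> * (h y - h xs + \<mu> / 2 * (norm (y - xs))\<^sup>2) \<le> \<tau> * (?G \<bullet> (y - xs))"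
    using tau by (intro mult_left_mono) (simp_all add: norm_minus_commute inner_diff_right)
  moreover have "(1 - s) * (1 - \<tau>) * (?G \<bullet> (xb - y)) \<le> (1 - s) * (1 - \<tau>) * (h xb - h y)"
  proof (intro mult_left_mono)
    have "h y + ?G \<bullet> (xb - y) + \<mu> / 2 * (norm (xb - y))\<^sup>2 \<le> h xb"
      using convex by (simp add: strongly_convex_def)
    moreover have "0 \<le> \<mu> / 2 * (norm (xb - y))\<^sup>2"
      using mu_pos by simp
    ultimately show "?G \<bullet> (xb - y) \<le> h xb - h y" by linarith
  qed (use tau in \<open>simp add: s_def\<close>)
  ultimately have "- (\<tau> * (?G \<bullet> Z)) \<le> - (\<tau> * (h y - h xs + \<mu> / 2 * (norm (y - xs))\<^sup>2))
      + (1 - s) * (?G \<bullet> (y - u) + (1 - \<tau>) * (h xb - h y))"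
    unfolding GZ by (simp add: algebra_simps)
  with Z_le have "\<mu> * (norm Y)\<^sup>2 \<le> \<mu> * ((1 - s) * (norm (x - xs))\<^sup>2 + s * (norm (y - xs))\<^sup>2)
      - \<tau> * (h y - h xs + \<mu> / 2 * (norm (y - xs))\<^sup>2)
      + (1 - s) * (?G \<bullet> (y - u) + (1 - \<tau>) * (h xb - h y)) + \<tau>\<^sup>2 / (4 * \<mu>) * (norm ?G)\<^sup>2"
    unfolding Y scale by linarith
  then show ?thesis
    unfolding scale by (simp add: s_def algebra_simps)
qed

end


section \<open>One iteration in expectation\<close>

text \<open>
  The weight of the gap in the potential changes with \<open>\<tau>\<close>; a step size that at most halves per
  iteration keeps consecutive weights compatible.
\<close>

locale similar_run = similar_problem P \<mu> \<delta>f \<delta>g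
  for P :: "'a::euclidean_space problem" and \<mu> \<delta>f \<delta>g :: real +
  fixes \<pi> :: params and x0 :: 'a and R :: "('w, 'a) run" and \<sigma> :: real
  assumes admissible: "admissible \<pi>"
    and theta_le: "\<And>k. theta \<pi> k \<le> 1 / (3 * (\<delta>f + \<delta>g))"
    and tau_sqrt: "\<And>k. tau \<pi> k = sqrt (\<mu> * theta \<pi> k)"
    and eta_min: "\<And>k. eta \<pi> k = min (1 / (2 * \<mu>)) (1 / 2 * sqrt (theta \<pi> k / \<mu>))"
    and alpha_mu: "alpha \<pi> = \<mu>"
    and tau_slow: "\<And>k. tau \<pi> k \<le> 2 * tau \<pi> (Suc k)"
    and run: "sc_acc_extragradient P \<pi> x0 R"
    and variance: "bounded_oracle_variance P \<pi> R \<sigma>"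
    and solved: "subproblems_solved P \<pi> R"
begin

abbreviation "\<tau> \<equiv> tau \<pi>"
abbreviation "\<theta> \<equiv> theta \<pi>"
abbreviation "p \<equiv> prob_f \<pi>"
abbreviation "M \<equiv> law R"

definition "oracle_error k \<omega> = xi P \<pi> R k \<omega> - dq (iter_under \<pi> R k \<omega>)"
definition "residual k \<omega> = grad (subproblem P \<pi> R k \<omega>) (iter_bar R (Suc k) \<omega>)"
definition "displacement k \<omega> = iter_bar R (Suc k) \<omega> - iter_under \<pi> R k \<omega>"
definition "new_grad k \<omega> = grad h (iter_bar R (Suc k) \<omega>)"
definition "grad_error k \<omega> = zeta P \<pi> R k \<omega> - new_grad k \<omega>"

text \<open>
  The next iterate relative to \<open>x\<^sub>*\<close> with the exact gradient in place of \<open>\<zeta>\<^sub>k\<close>; it is determined before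
  the choice of the second oracle.
\<close>

definition "drift k \<omega> = iter R k \<omega> - xs + (\<tau> k / 2) *\<^sub>R (iter_bar R (Suc k) \<omega> - iter R k \<omega>)
  - (\<tau> k / (2 * \<mu>)) *\<^sub>R new_grad k \<omega>"
definition "gap k \<omega> = h (iter_bar R k \<omega>) - h xs"

lemma tau_bounds: "0 < \<tau> k" "\<tau> k < 1" and theta_pos: "0 < \<theta> k" and p_bounds: "0 < p" "p < 1"
  using admissible by (auto simp: admissible_def)

lemma theta_curvature: "\<theta> k * (3 * (\<delta>f + \<delta>g)) \<le> 1"
proof -
  have "0 < 3 * (\<delta>f + \<delta>g)" using mu_pos delta by simp
  then show ?thesis
    using theta_le[of k] by (simp add: pos_le_divide_eq)
qed

lemma tau_square: "(\<tau> k)\<^sup>2 = \<mu> * \<theta> k"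
  using theta_pos[of k] mu_pos by (simp add: tau_sqrt)

text \<open>Since \<open>\<tau> < 1\<close>, the minimum in the choice of \<open>\<eta>\<close> is always its second argument.\<close>

lemma eta_tau: "eta \<pi> k = \<tau> k / (2 * \<mu>)"
proof -
  have "\<theta> k / \<mu> = (\<tau> k / \<mu>)\<^sup>2"
    using tau_square[of k] mu_pos by (simp add: power2_eq_square field_simps)
  then have "sqrt (\<theta> k / \<mu>) = \<tau> k / \<mu>"
    using tau_bounds[of k] mu_pos by (simp add: real_sqrt_abs)
  moreover have "\<tau> k / (2 * \<mu>) \<le> 1 / (2 * \<mu>)"
    using tau_bounds[of k] mu_pos by (intro divide_right_mono) simp_all
  ultimately show ?thesis by (simp add: eta_min min_def)
qed

lemma prob_space_run: "prob_space M"
  using run by (simp add: sc_acc_extragradient_def)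

interpretation M: prob_space M by (rule prob_space_run)

lemma info:
  "subalgebra M (info_xi R k)" "subalgebra M (info_zeta R k)"
  "subalgebra (info_zeta R k) (info_xi R k)" "subalgebra (info_xi R (Suc k)) (info_zeta R k)"
  using run by (auto simp: sc_acc_extragradient_def subalgebra_def)

lemma iteration:
  assumes "k < iters \<pi>"
  shows "fresh_choice M (info_xi R k) p (choice_xi R k)"
    "choice_xi R k \<in> measurable (info_zeta R k) (count_space UNIV)"
    "iter_bar R (Suc k) \<in> borel_measurable (info_zeta R k)"
    "fresh_choice M (info_zeta R k) p (choice_zeta R k)"
    "choice_zeta R k \<in> measurable (info_xi R (Suc k)) (count_space UNIV)"
    "\<And>\<omega>. \<omega> \<in> space M \<Longrightarrow> iter R (Suc k) \<omega> =
       iter R k \<omega> + (\<tau> k / 2) *\<^sub>R (iter_bar R (Suc k) \<omega> - iter R k \<omega>)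
       - (\<tau> k / (2 * \<mu>)) *\<^sub>R zeta P \<pi> R k \<omega>"
  using run assms mu_pos by (auto simp: sc_acc_extragradient_def eta_tau alpha_mu)

lemma choices_measurable:
  assumes "k < iters \<pi>"
  shows "choice_xi R k \<in> measurable M (count_space UNIV)"
    "choice_zeta R k \<in> measurable M (count_space UNIV)"
  using iteration[OF assms] info measurable_from_subalg by metis+

lemma grads_measurable:
  "grad h \<in> borel_measurable borel" "grad h1 \<in> borel_measurable borel"
  "dq \<in> borel_measurable borel"
  "oracle_xi P \<pi> c \<in> borel_measurable borel" "oracle_zeta P \<pi> c \<in> borel_measurable borel"
proof -
  note parts = twice_differentiable_parts[THEN grad_borel_measurable]
  show g: "grad h \<in> borel_measurable borel" "grad h1 \<in> borel_measurable borel"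
    using twice_differentiable_sums[THEN grad_borel_measurable] .
  have "dq = (\<lambda>x. grad h x - grad h1 x)" by (rule ext) (rule dq_eq)
  then show "dq \<in> borel_measurable borel"
    using g by simp
  have "oracle_xi P \<pi> c = (if c then (\<lambda>y. (1 / p) *\<^sub>R (grad (obj_f P) y - grad (server_f P) y))
      else (\<lambda>y. (1 / (1 - p)) *\<^sub>R (grad (obj_g P) y - grad (server_g P) y)))"
    by (auto simp: oracle_xi_def grad_diff[OF differentiable(1,3)] grad_diff[OF differentiable(2,4)])
  then show "oracle_xi P \<pi> c \<in> borel_measurable borel"
    using parts by (auto intro!: borel_measurable_const_scaleR)
  have "oracle_zeta P \<pi> c = (if c then (\<lambda>y. (1 / p) *\<^sub>R grad (obj_f P) y)
      else (\<lambda>y. (1 / (1 - p)) *\<^sub>R grad (obj_g P) y))"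
    by (auto simp: oracle_zeta_def)
  then show "oracle_zeta P \<pi> c \<in> borel_measurable borel"
    using parts by (auto intro!: borel_measurable_const_scaleR)
qed

lemma subproblem_model: "subproblem P \<pi> R k \<omega> = model (xi P \<pi> R k \<omega>) (\<theta> k) (iter_under \<pi> R k \<omega>)"
  by (rule ext) (simp add: subproblem_def model_def)

text \<open>
  Finite second moments and a finite expected gap are inherited from one iteration to the next, so
  that all expectations below are genuine integrals.
\<close>

definition invariant :: "nat \<Rightarrow> bool" where
  "invariant k \<longleftrightarrow>
     iter R k \<in> borel_measurable (info_xi R k) \<and> iter_bar R k \<in> borel_measurable (info_xi R k) \<and>
     square_integrable M (\<lambda>\<omega>. iter R k \<omega> - xs) \<and> square_integrable M (\<lambda>\<omega>. iter_bar R k \<omega> - xs) \<and>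
     integrable M (gap k)"

context
  fixes k
  assumes k: "k < iters \<pi>" and inv: "invariant k"
begin

lemma iter_under_facts:
  "iter_under \<pi> R k \<in> borel_measurable (info_xi R k)"
  "square_integrable M (\<lambda>\<omega>. iter_under \<pi> R k \<omega> - xs)"
proof -
  have "iter_under \<pi> R k = (\<lambda>\<omega>. \<tau> k *\<^sub>R iter R k \<omega> + (1 - \<tau> k) *\<^sub>R iter_bar R k \<omega>)"
    by (auto simp: iter_under_def)
  then show "iter_under \<pi> R k \<in> borel_measurable (info_xi R k)"
    using inv by (auto simp: invariant_def intro!: borel_measurable_const_scaleR)
  have "(\<lambda>\<omega>. iter_under \<pi> R k \<omega> - xs)
      = (\<lambda>\<omega>. \<tau> k *\<^sub>R (iter R k \<omega> - xs) + (1 - \<tau> k) *\<^sub>R (iter_bar R k \<omega> - xs))"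
    by (auto simp: iter_under_def algebra_simps)
  then show "square_integrable M (\<lambda>\<omega>. iter_under \<pi> R k \<omega> - xs)"
    using inv by (simp add: invariant_def square_integrable_intros)
qed

lemma oracle_error_facts:
  "square_integrable M (oracle_error k)" "(\<integral>\<omega>. (norm (oracle_error k \<omega>))\<^sup>2 \<partial>M) \<le> \<sigma>\<^sup>2"
proof -
  let ?n = "\<lambda>c z. oracle_xi P \<pi> c z - dq z"
  have eq: "oracle_error k = (\<lambda>\<omega>. ?n (choice_xi R k \<omega>) (iter_under \<pi> R k \<omega>))"
    by (auto simp: oracle_error_def xi_def)
  have var: "AE \<omega> in M. p * (norm (?n True (iter_under \<pi> R k \<omega>)))\<^sup>2
      + (1 - p) * (norm (?n False (iter_under \<pi> R k \<omega>)))\<^sup>2 \<le> \<sigma>\<^sup>2"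
    using variance k p_bounds unfolding bounded_oracle_variance_def
    by (auto elim!: allE[of _ k] simp: mult.commute)
  have n: "?n c \<in> borel_measurable borel" for c
    using grads_measurable by simp
  note noise = fresh_choice_noise[where n = ?n, OF prob_space_run info(1) iteration(1)[OF k] p_bounds
      choices_measurable(1)[OF k] n iter_under_facts(1) var]
  show "square_integrable M (oracle_error k)" "(\<integral>\<omega>. (norm (oracle_error k \<omega>))\<^sup>2 \<partial>M) \<le> \<sigma>\<^sup>2"
    unfolding eq by (rule noise(1), rule noise(2))
qed

lemma measurable_parts:
  "iter_under \<pi> R k \<in> borel_measurable M" "iter_bar R (Suc k) \<in> borel_measurable M"
  "displacement k \<in> borel_measurable M" "new_grad k \<in> borel_measurable (info_zeta R k)"
  "new_grad k \<in> borel_measurable M" "residual k \<in> borel_measurable M"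
proof -
  show u[measurable]: "iter_under \<pi> R k \<in> borel_measurable M"
    and y[measurable]: "iter_bar R (Suc k) \<in> borel_measurable M"
    using iter_under_facts(1) iteration(3)[OF k] info measurable_from_subalg by metis+
  show "displacement k \<in> borel_measurable M"
    unfolding displacement_def by simp
  show "new_grad k \<in> borel_measurable (info_zeta R k)"
    unfolding new_grad_def by (rule measurable_compose[OF iteration(3)[OF k] grads_measurable(1)])
  then show "new_grad k \<in> borel_measurable M"
    using info measurable_from_subalg by metis
  have "residual k = (\<lambda>\<omega>. oracle_error k \<omega> + dq (iter_under \<pi> R k \<omega>)
      + (1 / \<theta> k) *\<^sub>R (iter_bar R (Suc k) \<omega> - iter_under \<pi> R k \<omega>) + grad h1 (iter_bar R (Suc k) \<omega>))"
    by (auto simp: residual_def oracle_error_def subproblem_model grad_model theta_pos)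
  then show "residual k \<in> borel_measurable M"
    using square_integrableD(1)[OF oracle_error_facts(1)] measurable_compose[OF u grads_measurable(3)]
      measurable_compose[OF y grads_measurable(2)]
    by (auto intro!: borel_measurable_add borel_measurable_const_scaleR)
qed

lemma residual_nn_integral:
  "(\<integral>\<^sup>+\<omega>. ennreal ((norm (residual k \<omega>))\<^sup>2) \<partial>M) \<le> (\<integral>\<^sup>+\<omega>. ennreal (1 / (11 * (\<theta> k)\<^sup>2) *
     (norm (iter_under \<pi> R k \<omega> - minimizer (subproblem P \<pi> R k \<omega>)))\<^sup>2) \<partial>M)"
  using solved k by (simp add: subproblems_solved_def residual_def)

text \<open>
  The accuracy condition bounds the second moment of the residual by that of the distance between
  the prox centre and the exact solution, and the latter is finite by comparison with \<open>x\<^sub>*\<close>.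
\<close>

lemma residual_square_integrable: "square_integrable M (residual k)"
proof -
  let ?W = "\<lambda>\<omega>. 3 * norm (iter_under \<pi> R k \<omega> - xs) + 3 / 2 * \<theta> k * norm (oracle_error k \<omega>)"
  have W: "square_integrable M ?W"
    using square_integrable_add[OF
        square_integrable_scaleR[OF square_integrable_norm[OF iter_under_facts(2)]]
        square_integrable_scaleR[OF square_integrable_norm[OF oracle_error_facts(1)]],
        of 3 "3 / 2 * \<theta> k"] by simp
  have le: "norm (iter_under \<pi> R k \<omega> - minimizer (subproblem P \<pi> R k \<omega>)) \<le> ?W \<omega>" for \<omega>
    using model_minimizer_dist_xs[OF theta_pos[of k] theta_curvature[of k],
        where \<xi> = "xi P \<pi> R k \<omega>" and u = "iter_under \<pi> R k \<omega>"]
      norm_triangle_ineq4[of "iter_under \<pi> R k \<omega> - xs" "minimizer (subproblem P \<pi> R k \<omega>) - xs"]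
    by (simp add: subproblem_model oracle_error_def)
  have "(\<integral>\<^sup>+\<omega>. ennreal ((norm (residual k \<omega>))\<^sup>2) \<partial>M)
      \<le> (\<integral>\<^sup>+\<omega>. ennreal (1 / (11 * (\<theta> k)\<^sup>2) * (norm (?W \<omega>))\<^sup>2) \<partial>M)"
    using power_mono[OF le norm_ge_zero, of _ 2]
    by (intro order_trans[OF residual_nn_integral] nn_integral_mono ennreal_leI mult_left_mono) simp_all
  also have "\<dots> = ennreal (\<integral>\<omega>. 1 / (11 * (\<theta> k)\<^sup>2) * (norm (?W \<omega>))\<^sup>2 \<partial>M)"
    using square_integrableD(2)[OF W] by (intro nn_integral_eq_integral) simp_all
  also have "\<dots> < \<infinity>" by simp
  finally have "integrable M (\<lambda>\<omega>. (norm (residual k \<omega>))\<^sup>2)"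
    using measurable_parts(6) by (intro integrableI_bounded) simp_all
  then show ?thesis
    using measurable_parts(6) by (simp add: square_integrable_def)
qed

lemma new_bar_square_integrable: "square_integrable M (\<lambda>\<omega>. iter_bar R (Suc k) \<omega> - xs)"
proof -
  let ?W = "\<lambda>\<omega>. 3 / 2 * \<theta> k * norm (residual k \<omega>)
      + (2 * norm (iter_under \<pi> R k \<omega> - xs) + 3 / 2 * \<theta> k * norm (oracle_error k \<omega>))"
  have W: "square_integrable M ?W"
    using square_integrable_add[OF
        square_integrable_scaleR[OF square_integrable_norm[OF residual_square_integrable]]
        square_integrable_add[OF
        square_integrable_scaleR[OF square_integrable_norm[OF iter_under_facts(2)]]
        square_integrable_scaleR[OF square_integrable_norm[OF oracle_error_facts(1)]]],
        of "3 / 2 * \<theta> k" 2 "3 / 2 * \<theta> k"] by simp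
  have le: "norm (iter_bar R (Suc k) \<omega> - xs) \<le> ?W \<omega>" for \<omega>
    using model_minimizer_dist_xs[OF theta_pos[of k] theta_curvature[of k],
        where \<xi> = "xi P \<pi> R k \<omega>" and u = "iter_under \<pi> R k \<omega>"]
      model_minimizer_dist[OF theta_pos[of k] theta_curvature[of k],
        where y = "iter_bar R (Suc k) \<omega>" and \<xi> = "xi P \<pi> R k \<omega>" and u = "iter_under \<pi> R k \<omega>"]
      norm_triangle_ineq[of "iter_bar R (Suc k) \<omega> - minimizer (subproblem P \<pi> R k \<omega>)"
        "minimizer (subproblem P \<pi> R k \<omega>) - xs"]
    by (simp add: subproblem_model oracle_error_def residual_def)
  show ?thesis
  proof (rule square_integrable_lipschitz[OF _ W])
    show "norm (iter_bar R (Suc k) \<omega> - xs) \<le> 1 * norm (?W \<omega>)" for \<omega>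
      using le[of \<omega>] by simp
  qed (use measurable_parts in simp)
qed

lemma displacement_square_integrable: "square_integrable M (displacement k)"
  using square_integrable_diff[OF new_bar_square_integrable iter_under_facts(2)]
  by (simp add: displacement_def[abs_def])

text \<open>
  The gradient of \<open>h\<close> at the new point is square integrable because the subproblem expresses it
  through the displacement, the noise and the residual.
\<close>

lemma new_grad_square_integrable: "square_integrable M (new_grad k)"
proof -
  let ?q = "\<lambda>\<omega>. dq (iter_bar R (Suc k) \<omega>) - dq (iter_under \<pi> R k \<omega>)"
  have q: "square_integrable M ?q"
  proof (rule square_integrable_lipschitz[OF _ displacement_square_integrable])
    show "?q \<in> borel_measurable M"
      using measurable_compose[OF measurable_parts(1) grads_measurable(3)]
        measurable_compose[OF measurable_parts(2) grads_measurable(3)] by simp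
    show "norm (?q \<omega>) \<le> (\<delta>f + \<delta>g) * norm (displacement k \<omega>)" for \<omega>
      unfolding displacement_def by (rule dq_lipschitz)
  qed
  have "new_grad k = (\<lambda>\<omega>. ?q \<omega> + residual k \<omega> - oracle_error k \<omega> - (1 / \<theta> k) *\<^sub>R displacement k \<omega>)"
    by (auto simp: new_grad_def residual_def oracle_error_def displacement_def subproblem_model
        grad_model theta_pos dq_eq)
  then show ?thesis
    using q residual_square_integrable oracle_error_facts(1) displacement_square_integrable
    by (simp add: square_integrable_intros)
qed

text \<open>
  The exact solution is unknown, but its distance to the prox centre is at most the displacement
  plus a multiple of the residual, so the residual appears on both sides of the accuracy
  condition.  Absorbing it leaves \<open>(9 / 5) / (11 - 81 / 16) < 17 / 54\<close>, and twice \<open>17 / 54\<close> is what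
  the term \<open>- 17 / 27 \<bar>y - u\<bar>\<^sup>2\<close> of the descent inequality compensates.
\<close>

lemma residual_expectation:
  "(\<theta> k)\<^sup>2 * (\<integral>\<omega>. (norm (residual k \<omega>))\<^sup>2 \<partial>M) \<le> 17 / 54 * (\<integral>\<omega>. (norm (displacement k \<omega>))\<^sup>2 \<partial>M)"
proof -
  let ?R = "\<integral>\<omega>. (norm (residual k \<omega>))\<^sup>2 \<partial>M" and ?D = "\<integral>\<omega>. (norm (displacement k \<omega>))\<^sup>2 \<partial>M"
  let ?B = "\<lambda>\<omega>. 1 / (11 * (\<theta> k)\<^sup>2) *
    (9 / 5 * (norm (displacement k \<omega>))\<^sup>2 + 81 / 16 * (\<theta> k)\<^sup>2 * (norm (residual k \<omega>))\<^sup>2)"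
  note int = square_integrableD(2)[OF displacement_square_integrable]
    square_integrableD(2)[OF residual_square_integrable]
  have "ennreal ?R = (\<integral>\<^sup>+\<omega>. ennreal ((norm (residual k \<omega>))\<^sup>2) \<partial>M)"
    using nn_integral_norm_square[OF residual_square_integrable] by simp
  also have "\<dots> \<le> (\<integral>\<^sup>+\<omega>. ennreal (?B \<omega>) \<partial>M)"
    using model_minimizer_dist_square[OF theta_pos theta_curvature]
    by (intro order_trans[OF residual_nn_integral] nn_integral_mono ennreal_leI mult_left_mono)
      (simp_all add: subproblem_model displacement_def residual_def)
  also have "\<dots> = ennreal (\<integral>\<omega>. ?B \<omega> \<partial>M)"
    using int by (intro nn_integral_eq_integral) simp_all
  finally have "?R \<le> (\<integral>\<omega>. ?B \<omega> \<partial>M)"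
    by (subst (asm) ennreal_le_iff) (auto intro!: integral_nonneg_AE)
  also have "\<dots> = 1 / (11 * (\<theta> k)\<^sup>2) * (9 / 5 * ?D + 81 / 16 * (\<theta> k)\<^sup>2 * ?R)"
    using int by simp
  finally have "11 * (\<theta> k)\<^sup>2 * ?R \<le> 9 / 5 * ?D + 81 / 16 * (\<theta> k)\<^sup>2 * ?R"
    using theta_pos[of k] by (simp add: pos_le_divide_eq mult.commute)
  moreover have "0 \<le> ?D" by simp
  ultimately show ?thesis by linarith
qed

lemma descent_expectation:
  "(\<integral>\<omega>. new_grad k \<omega> \<bullet> displacement k \<omega> \<partial>M)
    \<le> 5 / 2 * \<theta> k * \<sigma>\<^sup>2 - \<theta> k / 2 * (\<integral>\<omega>. (norm (new_grad k \<omega>))\<^sup>2 \<partial>M)"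
proof -
  note int = square_integrableD(2)[OF displacement_square_integrable]
    square_integrableD(2)[OF residual_square_integrable]
    square_integrableD(2)[OF new_grad_square_integrable]
    square_integrableD(2)[OF oracle_error_facts(1)]
    integrable_inner_square_integrable[OF new_grad_square_integrable displacement_square_integrable]
  have "(\<integral>\<omega>. 2 * \<theta> k * (new_grad k \<omega> \<bullet> displacement k \<omega>) \<partial>M)
      \<le> (\<integral>\<omega>. 2 * (\<theta> k)\<^sup>2 * (norm (residual k \<omega>))\<^sup>2 - 17 / 27 * (norm (displacement k \<omega>))\<^sup>2
        + 5 * (\<theta> k)\<^sup>2 * (norm (oracle_error k \<omega>))\<^sup>2 - (\<theta> k)\<^sup>2 * (norm (new_grad k \<omega>))\<^sup>2 \<partial>M)"
    using int extragradient_descent[OF theta_pos theta_curvature]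
    by (intro integral_mono)
      (simp_all add: new_grad_def displacement_def residual_def oracle_error_def subproblem_model)
  also have "\<dots> = 2 * ((\<theta> k)\<^sup>2 * (\<integral>\<omega>. (norm (residual k \<omega>))\<^sup>2 \<partial>M))
      - 17 / 27 * (\<integral>\<omega>. (norm (displacement k \<omega>))\<^sup>2 \<partial>M)
      + 5 * (\<theta> k)\<^sup>2 * (\<integral>\<omega>. (norm (oracle_error k \<omega>))\<^sup>2 \<partial>M)
      - (\<theta> k)\<^sup>2 * (\<integral>\<omega>. (norm (new_grad k \<omega>))\<^sup>2 \<partial>M)"
    using int by simp
  also have "\<dots> \<le> 5 * (\<theta> k)\<^sup>2 * \<sigma>\<^sup>2 - (\<theta> k)\<^sup>2 * (\<integral>\<omega>. (norm (new_grad k \<omega>))\<^sup>2 \<partial>M)"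
    using residual_expectation mult_left_mono[OF oracle_error_facts(2), of "5 * (\<theta> k)\<^sup>2"] by simp
  finally have "(2 * \<theta> k) * (\<integral>\<omega>. new_grad k \<omega> \<bullet> displacement k \<omega> \<partial>M)
      \<le> (2 * \<theta> k) * (5 / 2 * \<theta> k * \<sigma>\<^sup>2 - \<theta> k / 2 * (\<integral>\<omega>. (norm (new_grad k \<omega>))\<^sup>2 \<partial>M))"
    by (simp add: power2_eq_square algebra_simps)
  then show ?thesis
    by (rule mult_left_le_imp_le) (use theta_pos[of k] in simp)
qed

lemma drift_facts:
  "drift k \<in> borel_measurable (info_zeta R k)" "square_integrable M (drift k)"
proof -
  have x: "iter R k \<in> borel_measurable (info_zeta R k)"
    using inv info measurable_from_subalg unfolding invariant_def by metis
  show "drift k \<in> borel_measurable (info_zeta R k)"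
    unfolding drift_def[abs_def] using x iteration(3)[OF k] measurable_parts(4)
    by (auto intro!: borel_measurable_diff borel_measurable_add borel_measurable_const_scaleR)
  have old: "square_integrable M (\<lambda>\<omega>. iter R k \<omega> - xs)"
    using inv by (simp add: invariant_def)
  have eq: "drift k = (\<lambda>\<omega>. (iter R k \<omega> - xs)
      + (\<tau> k / 2) *\<^sub>R ((iter_bar R (Suc k) \<omega> - xs) - (iter R k \<omega> - xs))
      - (\<tau> k / (2 * \<mu>)) *\<^sub>R new_grad k \<omega>)"
    by (auto simp: drift_def)
  show "square_integrable M (drift k)"
    unfolding eq
    by (rule square_integrable_diff[OF square_integrable_add[OF old square_integrable_scaleR[OF
          square_integrable_diff[OF new_bar_square_integrable old]]]
          square_integrable_scaleR[OF new_grad_square_integrable]])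
qed

lemma grad_error_facts:
  "square_integrable M (grad_error k)" "(\<integral>\<omega>. (norm (grad_error k \<omega>))\<^sup>2 \<partial>M) \<le> \<sigma>\<^sup>2"
  "(\<integral>\<omega>. grad_error k \<omega> \<bullet> drift k \<omega> \<partial>M) = 0"
proof -
  let ?n = "\<lambda>c z. oracle_zeta P \<pi> c z - grad h z"
  have eq: "grad_error k = (\<lambda>\<omega>. ?n (choice_zeta R k \<omega>) (iter_bar R (Suc k) \<omega>))"
    by (auto simp: grad_error_def zeta_def new_grad_def)
  have var: "AE \<omega> in M. p * (norm (?n True (iter_bar R (Suc k) \<omega>)))\<^sup>2
      + (1 - p) * (norm (?n False (iter_bar R (Suc k) \<omega>)))\<^sup>2 \<le> \<sigma>\<^sup>2"
    using variance k p_bounds unfolding bounded_oracle_variance_def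
    by (auto elim!: allE[of _ k] simp: mult.commute)
  have n: "?n c \<in> borel_measurable borel" for c
    using grads_measurable by simp
  note noise = fresh_choice_noise[where n = ?n, OF prob_space_run info(2) iteration(4)[OF k] p_bounds
      choices_measurable(2)[OF k] n iteration(3)[OF k] var]
  show "square_integrable M (grad_error k)" "(\<integral>\<omega>. (norm (grad_error k \<omega>))\<^sup>2 \<partial>M) \<le> \<sigma>\<^sup>2"
    unfolding eq by (rule noise(1), rule noise(2))
  have "p *\<^sub>R ?n True z + (1 - p) *\<^sub>R ?n False z = 0" for z
    using p_bounds by (simp add: oracle_zeta_def grad_h scaleR_diff_right algebra_simps)
  then show "(\<integral>\<omega>. grad_error k \<omega> \<bullet> drift k \<omega> \<partial>M) = 0"
    unfolding eq by (rule noise(3)[OF _ drift_facts])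
qed

lemma iter_Suc_drift:
  assumes "\<omega> \<in> space M"
  shows "iter R (Suc k) \<omega> - xs = drift k \<omega> - (\<tau> k / (2 * \<mu>)) *\<^sub>R grad_error k \<omega>"
  unfolding iteration(6)[OF k assms] drift_def grad_error_def by (simp add: scaleR_diff_right)

text \<open>By convexity the gap at the new point \<open>y\<close> is at most \<open>\<langle>\<nabla>h(y), y - x\<^sub>*\<rangle>\<close>, a product of square integrable vectors.\<close>

lemma new_gap_integrable: "integrable M (gap (Suc k))"
proof (rule Bochner_Integration.integrable_bound)
  show "integrable M (\<lambda>\<omega>. new_grad k \<omega> \<bullet> (iter_bar R (Suc k) \<omega> - xs))"
    by (rule integrable_inner_square_integrable[OF new_grad_square_integrable new_bar_square_integrable])
  have "h \<in> borel_measurable borel"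
    using differentiable(5) by (intro borel_measurable_continuous_onI differentiable_imp_continuous_on)
      (simp add: differentiable_on_def)
  then show "gap (Suc k) \<in> borel_measurable M"
    unfolding gap_def[abs_def]
    by (intro borel_measurable_diff borel_measurable_const measurable_compose[OF measurable_parts(2)])
  have "gap (Suc k) \<omega> \<le> new_grad k \<omega> \<bullet> (iter_bar R (Suc k) \<omega> - xs)" for \<omega>
  proof -
    let ?y = "iter_bar R (Suc k) \<omega>"
    have "h ?y + grad h ?y \<bullet> (xs - ?y) + \<mu> / 2 * (norm (xs - ?y))\<^sup>2 \<le> h xs"
      using convex by (simp add: strongly_convex_def)
    moreover have "0 \<le> \<mu> / 2 * (norm (xs - ?y))\<^sup>2"
      using mu_pos by simp
    ultimately show ?thesis
      by (simp add: gap_def new_grad_def inner_diff_right)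
  qed
  then show "AE \<omega> in M. norm (gap (Suc k) \<omega>) \<le> norm (new_grad k \<omega> \<bullet> (iter_bar R (Suc k) \<omega> - xs))"
    using h_gap_nonneg unfolding gap_def by (intro AE_I2) (smt (verit) real_norm_def)
qed

lemma invariant_Suc: "invariant (Suc k)"
proof -
  have y: "iter_bar R (Suc k) \<in> borel_measurable (info_xi R (Suc k))"
    using iteration(3)[OF k] info measurable_from_subalg by metis
  have G: "new_grad k \<in> borel_measurable (info_xi R (Suc k))"
    "drift k \<in> borel_measurable (info_xi R (Suc k))"
    using measurable_parts(4) drift_facts(1) info measurable_from_subalg by metis+
  have [measurable]: "choice_zeta R k \<in> measurable (info_xi R (Suc k)) (count_space UNIV)"
    by (rule iteration(5)[OF k])
  have z[measurable]: "(\<lambda>\<omega>. oracle_zeta P \<pi> c (iter_bar R (Suc k) \<omega>)) \<in> borel_measurable (info_xi R (Suc k))"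
    for c using measurable_compose[OF y grads_measurable(5)] .
  have "zeta P \<pi> R k = (\<lambda>\<omega>. if choice_zeta R k \<omega> then oracle_zeta P \<pi> True (iter_bar R (Suc k) \<omega>)
      else oracle_zeta P \<pi> False (iter_bar R (Suc k) \<omega>))"
    by (auto simp: zeta_def)
  then have "zeta P \<pi> R k \<in> borel_measurable (info_xi R (Suc k))" by simp
  then have "(\<lambda>\<omega>. xs + (drift k \<omega> - (\<tau> k / (2 * \<mu>)) *\<^sub>R grad_error k \<omega>))
      \<in> borel_measurable (info_xi R (Suc k))"
    unfolding grad_error_def using G
    by (auto intro!: borel_measurable_diff borel_measurable_add borel_measurable_const_scaleR)
  moreover have "iter R (Suc k) \<omega> = xs + (drift k \<omega> - (\<tau> k / (2 * \<mu>)) *\<^sub>R grad_error k \<omega>)"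
    if "\<omega> \<in> space (info_xi R (Suc k))" for \<omega>
    using iter_Suc_drift[of \<omega>] that info(1)[of "Suc k"] by (simp add: subalgebra_def algebra_simps)
  ultimately have x: "iter R (Suc k) \<in> borel_measurable (info_xi R (Suc k))"
    by (subst measurable_cong)
  have "square_integrable M (\<lambda>\<omega>. drift k \<omega> - (\<tau> k / (2 * \<mu>)) *\<^sub>R grad_error k \<omega>)"
    using drift_facts(2) grad_error_facts(1) by (intro square_integrable_intros)
  then have "square_integrable M (\<lambda>\<omega>. iter R (Suc k) \<omega> - xs)"
    unfolding square_integrable_def
    by (simp add: iter_Suc_drift cong: measurable_cong Bochner_Integration.integrable_cong)
  then show ?thesis
    using x y new_bar_square_integrable new_gap_integrable by (simp add: invariant_def)
qed

end

definition potential :: "nat \<Rightarrow> real" where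
  "potential k = \<mu> * (\<integral>\<omega>. (norm (iter R k \<omega> - xs))\<^sup>2 \<partial>M) + (1 - \<tau> k) * (\<integral>\<omega>. gap k \<omega> \<partial>M)"

text \<open>
  In the expectation of the coupling inequality the unbiased noise vanishes.  The squared gradient
  gains \<open>\<tau>\<^sup>2 / (4 \<mu>)\<close> from the step length and loses \<open>(1 - \<tau> / 2) \<theta> / 2\<close> from the descent, where
  \<open>\<theta> = \<tau>\<^sup>2 / \<mu>\<close>.  The gap at the new point has the coefficient \<open>\<tau> + (1 - \<tau> / 2) (1 - \<tau>) \<ge> 1 - \<tau> / 2\<close>, and
  the gap at the old point has \<open>(1 - \<tau> / 2) (1 - \<tau>)\<close>: both parts of the potential contract by
  \<open>1 - \<tau> / 2\<close>.
\<close>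

lemma potential_Suc:
  assumes k: "k < iters \<pi>" and inv: "invariant k"
  shows "potential (Suc k) \<le> (1 - \<tau> k / 2) * potential k + 3 * \<sigma>\<^sup>2 / \<mu> * (\<tau> k)\<^sup>2"
proof -
  note A = k inv
  let ?X = "\<integral>\<omega>. (norm (iter R k \<omega> - xs))\<^sup>2 \<partial>M" and ?X' = "\<integral>\<omega>. (norm (iter R (Suc k) \<omega> - xs))\<^sup>2 \<partial>M"
  let ?H = "\<integral>\<omega>. gap k \<omega> \<partial>M" and ?H' = "\<integral>\<omega>. gap (Suc k) \<omega> \<partial>M"
  let ?GD = "\<integral>\<omega>. new_grad k \<omega> \<bullet> displacement k \<omega> \<partial>M" and ?G2 = "\<integral>\<omega>. (norm (new_grad k \<omega>))\<^sup>2 \<partial>M"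
  let ?N2 = "\<integral>\<omega>. (norm (grad_error k \<omega>))\<^sup>2 \<partial>M"
  let ?a = "1 - \<tau> k / 2" and ?c = "(\<tau> k)\<^sup>2 / (4 * \<mu>)"
  have inv': "integrable M (\<lambda>\<omega>. (norm (iter R k \<omega> - xs))\<^sup>2)" "integrable M (gap k)"
    "integrable M (\<lambda>\<omega>. (norm (iter R (Suc k) \<omega> - xs))\<^sup>2)"
    using inv invariant_Suc[OF A] by (auto simp: invariant_def square_integrable_def)
  note int = inv' new_gap_integrable[OF A] square_integrableD(2)[OF new_grad_square_integrable[OF A]]
    square_integrableD(2)[OF grad_error_facts(1)[OF A]]
    integrable_inner_square_integrable[OF new_grad_square_integrable[OF A] displacement_square_integrable[OF A]]
    integrable_inner_square_integrable[OF grad_error_facts(1)[OF A] drift_facts(2)[OF A]]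
  have "(\<integral>\<omega>. \<mu> * (norm (iter R (Suc k) \<omega> - xs))\<^sup>2 \<partial>M)
    \<le> (\<integral>\<omega>. \<mu> * ?a * (norm (iter R k \<omega> - xs))\<^sup>2 - \<tau> k * gap (Suc k) \<omega>
      + ?a * (new_grad k \<omega> \<bullet> displacement k \<omega> + (1 - \<tau> k) * (gap k \<omega> - gap (Suc k) \<omega>))
      + ?c * (norm (new_grad k \<omega>))\<^sup>2 - \<tau> k * (grad_error k \<omega> \<bullet> drift k \<omega>)
      + ?c * (norm (grad_error k \<omega>))\<^sup>2 \<partial>M)"
  proof (rule integral_mono)
    fix \<omega> assume "\<omega> \<in> space M"
    then show "\<mu> * (norm (iter R (Suc k) \<omega> - xs))\<^sup>2 \<le> \<mu> * ?a * (norm (iter R k \<omega> - xs))\<^sup>2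
      - \<tau> k * gap (Suc k) \<omega>
      + ?a * (new_grad k \<omega> \<bullet> displacement k \<omega> + (1 - \<tau> k) * (gap k \<omega> - gap (Suc k) \<omega>))
      + ?c * (norm (new_grad k \<omega>))\<^sup>2 - \<tau> k * (grad_error k \<omega> \<bullet> drift k \<omega>)
      + ?c * (norm (grad_error k \<omega>))\<^sup>2"
      unfolding iter_Suc_drift[OF A \<open>\<omega> \<in> space M\<close>] drift_def gap_def new_grad_def displacement_def
      by (intro coupling_step tau_bounds iter_under_def)
  qed (use int in simp_all)
  then have "\<mu> * ?X' \<le> \<mu> * ?a * ?X - \<tau> k * ?H' + ?a * (?GD + (1 - \<tau> k) * (?H - ?H'))
      + ?c * ?G2 - \<tau> k * 0 + ?c * ?N2"
    using int by (simp add: grad_error_facts(3)[OF A])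
  also have "\<dots> \<le> \<mu> * ?a * ?X - \<tau> k * ?H'
      + ?a * ((5 / 2 * \<theta> k * \<sigma>\<^sup>2 - \<theta> k / 2 * ?G2) + (1 - \<tau> k) * (?H - ?H')) + ?c * ?G2 - \<tau> k * 0 + ?c * \<sigma>\<^sup>2"
    using descent_expectation[OF A] grad_error_facts(2)[OF A] tau_bounds[of k] mu_pos
    by (intro add_mono diff_mono mult_left_mono) simp_all
  moreover have "m * X + (t + a * (1 - t)) * H \<le> a * (m * X' + (1 - t) * H') + (c - a * d) * G + (a * b + c) * s"
    if "m * X \<le> m * a * X' - t * H + a * ((b * s - d * G) + (1 - t) * (H' - H)) + c * G - t * 0 + c * s"
    for m X t a H X' H' c d G b s :: real
    using that by (simp add: algebra_simps)
  ultimately have step: "\<mu> * ?X' + (\<tau> k + ?a * (1 - \<tau> k)) * ?H'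
      \<le> ?a * (\<mu> * ?X + (1 - \<tau> k) * ?H) + (?c - ?a * (\<theta> k / 2)) * ?G2 + (?a * (5 / 2 * \<theta> k) + ?c) * \<sigma>\<^sup>2"
    by (meson order_trans)
  have theta: "\<theta> k = (\<tau> k)\<^sup>2 / \<mu>"
    using tau_square[of k] mu_pos by (simp add: field_simps)
  have "?c - ?a * (\<theta> k / 2) = - ((\<tau> k)\<^sup>2 / (4 * \<mu>) * (1 - \<tau> k))"
    using mu_pos by (simp add: theta field_simps)
  also have "\<dots> \<le> 0"
    using mu_pos tau_bounds[of k] by simp
  finally have G2: "(?c - ?a * (\<theta> k / 2)) * ?G2 \<le> 0"
    by (intro mult_nonpos_nonneg) simp_all
  have "?a * (5 / 2 * \<theta> k) + ?c = ((\<tau> k)\<^sup>2 / \<mu>) * (5 / 2 * ?a + 1 / 4)"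
    using mu_pos by (simp add: theta field_simps)
  also have "\<dots> \<le> ((\<tau> k)\<^sup>2 / \<mu>) * 3"
  proof (intro mult_left_mono)
    show "5 / 2 * ?a + 1 / 4 \<le> 3" using tau_bounds[of k] by (simp add: field_simps)
  qed (use mu_pos in simp)
  finally have "(?a * (5 / 2 * \<theta> k) + ?c) * \<sigma>\<^sup>2 \<le> ((\<tau> k)\<^sup>2 / \<mu>) * 3 * \<sigma>\<^sup>2"
    by (rule mult_right_mono) simp
  then have N2: "(?a * (5 / 2 * \<theta> k) + ?c) * \<sigma>\<^sup>2 \<le> 3 * \<sigma>\<^sup>2 / \<mu> * (\<tau> k)\<^sup>2"
    by (simp add: mult_ac)
  have "1 - \<tau> (Suc k) \<le> 1 - \<tau> k / 2"
    using tau_slow[of k] by simp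
  also have "\<dots> \<le> \<tau> k + ?a * (1 - \<tau> k)"
    by (simp add: field_simps)
  finally have "(1 - \<tau> (Suc k)) * ?H' \<le> (\<tau> k + ?a * (1 - \<tau> k)) * ?H'"
    using h_gap_nonneg by (intro mult_right_mono) (simp_all add: gap_def)
  with step G2 N2 show ?thesis
    unfolding potential_def by linarith
qed

lemma invariant: "k \<le> iters \<pi> \<Longrightarrow> invariant k"
proof (induction k)
  case 0
  have 0: "iter R 0 \<omega> = x0" "iter_bar R 0 \<omega> = x0" if "\<omega> \<in> space M" for \<omega>
    using run that by (auto simp: sc_acc_extragradient_def)
  have "iter R 0 \<in> borel_measurable (info_xi R 0) \<longleftrightarrow> (\<lambda>_. x0) \<in> borel_measurable (info_xi R 0)"
    "iter_bar R 0 \<in> borel_measurable (info_xi R 0) \<longleftrightarrow> (\<lambda>_. x0) \<in> borel_measurable (info_xi R 0)"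
    using info(1)[of 0] 0 by (intro measurable_cong; simp add: subalgebra_def)+
  then have "iter R 0 \<in> borel_measurable (info_xi R 0)" "iter_bar R 0 \<in> borel_measurable (info_xi R 0)"
    by simp_all
  moreover have "integrable M (gap 0)"
    using 0 by (simp add: gap_def[abs_def] cong: Bochner_Integration.integrable_cong)
  moreover have "square_integrable M (\<lambda>\<omega>. iter R 0 \<omega> - xs)" "square_integrable M (\<lambda>\<omega>. iter_bar R 0 \<omega> - xs)"
    using 0 by (simp_all add: square_integrable_def cong: measurable_cong Bochner_Integration.integrable_cong)
  ultimately show ?case by (simp add: invariant_def)
qed (simp add: invariant_Suc)

lemma potential_0: "potential 0 \<le> initial_error P \<mu> x0"
proof -
  have 0: "iter R 0 \<omega> = x0" "iter_bar R 0 \<omega> = x0" if "\<omega> \<in> space M" for \<omega>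
    using run that by (auto simp: sc_acc_extragradient_def)
  have "potential 0 = \<mu> * (norm (x0 - xs))\<^sup>2 + (1 - \<tau> 0) * (h x0 - h xs)"
    using 0 by (simp add: potential_def gap_def M.prob_space cong: Bochner_Integration.integral_cong)
  also have "(1 - \<tau> 0) * (h x0 - h xs) \<le> 1 * (h x0 - h xs)"
    using h_gap_nonneg tau_bounds[of 0] by (intro mult_right_mono) simp_all
  finally show ?thesis by (simp add: initial_error_def)
qed

lemma eps_solutionI:
  assumes "\<mu> * (\<integral>\<omega>. (norm (iter R (iters \<pi>) \<omega> - xs))\<^sup>2 \<partial>M) \<le> \<epsilon>"
  shows "eps_solution P \<pi> R \<mu> \<epsilon>"
proof -
  have "square_integrable M (\<lambda>\<omega>. iter R (iters \<pi>) \<omega> - xs)"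
    using invariant[of "iters \<pi>"] by (simp add: invariant_def)
  then show ?thesis
    unfolding eps_solution_def using assms mu_pos
    by (simp add: nn_integral_norm_square ennreal_leI flip: ennreal_mult)
qed

lemma eps_solution_if_potential_le:
  assumes "potential (iters \<pi>) \<le> \<epsilon>"
  shows "eps_solution P \<pi> R \<mu> \<epsilon>"
proof (rule eps_solutionI)
  have "0 \<le> (1 - \<tau> (iters \<pi>)) * (\<integral>\<omega>. gap (iters \<pi>) \<omega> \<partial>M)"
    using tau_bounds[of "iters \<pi>"] h_gap_nonneg by (intro mult_nonneg_nonneg) (simp_all add: gap_def)
  then show "\<mu> * (\<integral>\<omega>. (norm (iter R (iters \<pi>) \<omega> - xs))\<^sup>2 \<partial>M) \<le> \<epsilon>"
    using assms by (simp add: potential_def)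
qed

text \<open>
  The gap at \<open>x\<^sub>0\<close> is at least \<open>\<mu> / 2\<close> times the squared distance, so the distance accounts for at most
  two thirds of the initial error.  This covers target accuracies so close to the initial error
  that \<open>ln (C\<^sub>0 / \<epsilon>)\<close> does not even pay for a single iteration.
\<close>

lemma eps_solution_initial:
  assumes "iters \<pi> = 0" "2 / 3 * initial_error P \<mu> x0 \<le> \<epsilon>"
  shows "eps_solution P \<pi> R \<mu> \<epsilon>"
proof (rule eps_solutionI)
  have "\<mu> * (\<integral>\<omega>. (norm (iter R 0 \<omega> - xs))\<^sup>2 \<partial>M) = \<mu> * (norm (x0 - xs))\<^sup>2"
    using run by (simp add: sc_acc_extragradient_def M.prob_space cong: Bochner_Integration.integral_cong)
  also have "\<dots> \<le> 2 / 3 * initial_error P \<mu> x0"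
    using h_gap_quadratic[of x0] by (simp add: initial_error_def)
  finally show "\<mu> * (\<integral>\<omega>. (norm (iter R (iters \<pi>) \<omega> - xs))\<^sup>2 \<partial>M) \<le> \<epsilon>"
    using assms by simp
qed

lemma expected_rounds:
  "(\<integral>\<omega>. real (rounds_f \<pi> R \<omega>) \<partial>M) = 2 * p * iters \<pi>"
  "(\<integral>\<omega>. real (rounds_g \<pi> R \<omega>) \<partial>M) = 2 * (1 - p) * iters \<pi>"
proof -
  have p: "0 \<le> p" "p \<le> 1" using p_bounds by simp_all
  have exp: "(\<integral>\<omega>. (\<Sum>k<iters \<pi>. \<phi> (choice_xi R k \<omega>) + \<phi> (choice_zeta R k \<omega>)) \<partial>M)
      = 2 * (p * \<phi> True + (1 - p) * \<phi> False) * iters \<pi>" for \<phi> :: "bool \<Rightarrow> real"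
  proof -
    have int: "integrable M (\<lambda>\<omega>. \<phi> (b \<omega>))" if "b \<in> measurable M (count_space UNIV)" for b
    proof (rule M.integrable_const_bound[where B = "\<bar>\<phi> True\<bar> + \<bar>\<phi> False\<bar>"])
      have "norm (\<phi> c) \<le> \<bar>\<phi> True\<bar> + \<bar>\<phi> False\<bar>" for c by (cases c) simp_all
      then show "AE \<omega> in M. norm (\<phi> (b \<omega>)) \<le> \<bar>\<phi> True\<bar> + \<bar>\<phi> False\<bar>" by simp
      show "(\<lambda>\<omega>. \<phi> (b \<omega>)) \<in> borel_measurable M"
        by (rule measurable_compose[OF that]) simp
    qed
    have "(\<integral>\<omega>. (\<Sum>k<iters \<pi>. \<phi> (choice_xi R k \<omega>) + \<phi> (choice_zeta R k \<omega>)) \<partial>M)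
        = (\<Sum>k<iters \<pi>. (\<integral>\<omega>. \<phi> (choice_xi R k \<omega>) \<partial>M) + (\<integral>\<omega>. \<phi> (choice_zeta R k \<omega>) \<partial>M))"
      using int choices_measurable by (subst Bochner_Integration.integral_sum) auto
    also have "\<dots> = (\<Sum>k<iters \<pi>. 2 * (p * \<phi> True + (1 - p) * \<phi> False))"
      using fresh_choice_expectation[OF iteration(1) p choices_measurable(1), where \<phi> = \<phi>]
        fresh_choice_expectation[OF iteration(4) p choices_measurable(2), where \<phi> = \<phi>]
      by (intro sum.cong refl) simp
    finally show ?thesis by simp
  qed
  show "(\<integral>\<omega>. real (rounds_f \<pi> R \<omega>) \<partial>M) = 2 * p * iters \<pi>"
    using exp[of of_bool] by (simp add: rounds_f_def)
  show "(\<integral>\<omega>. real (rounds_g \<pi> R \<omega>) \<partial>M) = 2 * (1 - p) * iters \<pi>"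
    using exp[of "\<lambda>c. of_bool (\<not> c)"] by (simp add: rounds_g_def)
qed

end


section \<open>Step size schedules\<close>

text \<open>A contraction by \<open>1 - t / 2\<close> with an error \<open>c t\<^sup>2\<close> per step has the fixed point \<open>2 c t\<close>, the noise floor.\<close>

lemma constant_schedule_bound:
  fixes \<Phi> :: "nat \<Rightarrow> real"
  assumes "\<And>k. k < N \<Longrightarrow> \<Phi> (Suc k) \<le> (1 - t / 2) * \<Phi> k + c * t\<^sup>2"
    and "0 < t" "t < 1" "0 \<le> c" "0 \<le> C" "\<Phi> 0 \<le> C"
  shows "\<Phi> N \<le> exp (- (t * N / 2)) * C + 2 * c * t"
proof -
  have "k \<le> N \<Longrightarrow> \<Phi> k \<le> (1 - t / 2) ^ k * C + 2 * c * t" for k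
  proof (induction k)
    case 0
    have "0 \<le> 2 * c * t" using assms by simp
    then show ?case using assms(6) by simp
  next
    case (Suc k)
    have "\<Phi> (Suc k) \<le> (1 - t / 2) * \<Phi> k + c * t\<^sup>2"
      using Suc.prems by (intro assms(1)) simp
    also have "\<dots> \<le> (1 - t / 2) * ((1 - t / 2) ^ k * C + 2 * c * t) + c * t\<^sup>2"
      using Suc assms by (intro add_right_mono mult_left_mono) simp_all
    also have "\<dots> = (1 - t / 2) ^ Suc k * C + 2 * c * t"
      by (simp add: algebra_simps power2_eq_square)
    finally show ?case .
  qed
  then have "\<Phi> N \<le> (1 - t / 2) ^ N * C + 2 * c * t" by simp
  also have "(1 - t / 2) ^ N \<le> exp (- (t / 2)) ^ N"
    using exp_ge_add_one_self[of "- (t / 2)"] assms by (intro power_mono) simp_all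
  also have "exp (- (t / 2)) ^ N = exp (- (t * N / 2))"
    by (simp add: mult_ac flip: exp_of_nat_mult)
  finally show ?thesis
    using assms(5) by (simp add: mult_right_mono)
qed

text \<open>
  With \<open>t\<^sub>k = 4 / s\<close> and \<open>t\<^sub>k\<^sub>+\<^sub>1 = 4 / (s + 1)\<close> the bound \<open>4 c t\<^sub>k\<close> reproduces itself, because
  \<open>t\<^sub>k - t\<^sub>k\<^sub>+\<^sub>1 \<le> t\<^sub>k\<^sup>2 / 4\<close>.
\<close>

lemma harmonic_schedule_bound:
  fixes \<Phi> :: "nat \<Rightarrow> real" and m c :: real
  defines "t \<equiv> \<lambda>j. 4 / (real j + m)"
  assumes "\<And>j. j < n \<Longrightarrow> \<Phi> (Suc j) \<le> (1 - t j / 2) * \<Phi> j + c * (t j)\<^sup>2"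
    and "4 \<le> m" "0 \<le> c" "\<Phi> 0 \<le> 4 * c * t 0"
  shows "\<Phi> n \<le> 4 * c * t n"
proof -
  have "j \<le> n \<Longrightarrow> \<Phi> j \<le> 4 * c * t j" for j
  proof (induction j)
    case (Suc j)
    define s where "s = real j + m"
    have s: "4 \<le> s" "t j = 4 / s" "t (Suc j) = 4 / (s + 1)"
      using assms(3) by (auto simp: s_def t_def add_ac)
    have "\<Phi> (Suc j) \<le> (1 - t j / 2) * \<Phi> j + c * (t j)\<^sup>2"
      using Suc.prems by (intro assms(2)) simp
    also have "\<dots> \<le> (1 - t j / 2) * (4 * c * t j) + c * (t j)\<^sup>2"
    proof (intro add_right_mono mult_left_mono)
      show "0 \<le> 1 - t j / 2" using s(1) unfolding s(2) by (simp add: field_simps)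
    qed (use Suc in simp)
    also have "\<dots> = c * (4 * t j - (t j)\<^sup>2)"
      by (simp add: algebra_simps power2_eq_square)
    also have "\<dots> \<le> c * (4 * t (Suc j))"
    proof (intro mult_left_mono)
      have "4 * t (Suc j) - (4 * t j - (t j)\<^sup>2) = 16 / (s\<^sup>2 * (s + 1))"
        using s(1) unfolding s(2,3) by (simp add: field_simps power2_eq_square)
      also have "\<dots> \<ge> 0" using s(1) by simp
      finally show "4 * t j - (t j)\<^sup>2 \<le> 4 * t (Suc j)" by simp
    qed fact
    finally show ?case by simp
  qed (use assms in simp)
  then show ?thesis by simp
qed

text \<open>The recursion of the potential is a recursion in \<open>\<tau>\<close>, so \<open>\<theta>\<close> is recovered from \<open>\<tau> = sqrt (\<mu> \<theta>)\<close>.\<close>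

definition schedule :: "real \<Rightarrow> (nat \<Rightarrow> real) \<Rightarrow> real \<Rightarrow> nat \<Rightarrow> params" where
  "schedule \<mu> t p N =
     \<lparr>theta = (\<lambda>k. (t k)\<^sup>2 / \<mu>), tau = t,
      eta = (\<lambda>k. min (1 / (2 * \<mu>)) (1 / 2 * sqrt ((t k)\<^sup>2 / \<mu> / \<mu>))),
      alpha = \<mu>, prob_f = p, iters = N\<rparr>"

locale step_sizes =
  fixes \<mu> \<delta>f \<delta>g :: real
  assumes mu_pos: "0 < \<mu>" and delta: "\<mu> < \<delta>f" "\<delta>f < \<delta>g"
begin

text \<open>
  The two roots govern the numbers of rounds.  Calling the nodes of \<open>f\<close> with probability proportional
  to \<open>root_f\<close> splits the iterations, whose number is of order \<open>1 / tau_max\<close> and hence of order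
  \<open>root_f + root_g\<close>, in the ratio of the two targets.
\<close>

definition "root_f = sqrt (\<delta>f / \<mu>)"
definition "root_g = sqrt (\<delta>g / \<mu>)"
definition "share_f = root_f / (root_f + root_g)"
definition "tau_max = sqrt (\<mu> / (3 * (\<delta>f + \<delta>g)))"

lemma roots: "1 < root_f" "root_f < root_g"
  using mu_pos delta by (simp_all add: root_f_def root_g_def divide_strict_right_mono)

lemma share_f_bounds: "0 < share_f" "share_f < 1"
  using roots by (simp_all add: share_f_def)

lemma tau_max_square: "tau_max\<^sup>2 = \<mu> / (3 * (\<delta>f + \<delta>g))"
  using mu_pos delta by (simp add: tau_max_def)

lemma tau_max_bounds: "0 < tau_max" "tau_max < 1"
  using mu_pos delta by (simp_all add: tau_max_def)

lemma inverse_tau_max: "1 / tau_max \<le> 2 * (root_f + root_g)"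
proof (rule power2_le_imp_le)
  have "(1 / tau_max)\<^sup>2 = 3 * (root_f\<^sup>2 + root_g\<^sup>2)"
    using mu_pos delta by (simp add: power_divide tau_max_square root_f_def root_g_def field_simps)
  also have "\<dots> \<le> 4 * (root_f\<^sup>2 + root_g\<^sup>2 + 2 * root_f * root_g)"
    using roots by (intro mult_mono) simp_all
  also have "\<dots> = (2 * (root_f + root_g))\<^sup>2"
    by (simp add: power2_eq_square algebra_simps)
  finally show "(1 / tau_max)\<^sup>2 \<le> (2 * (root_f + root_g))\<^sup>2" .
qed (use roots in simp)

lemma root_g_tau_max: "1 / 6 \<le> root_g * tau_max" "root_g * tau_max \<le> 2 / 3"
proof -
  have square: "(root_g * tau_max)\<^sup>2 = \<delta>g / (3 * (\<delta>f + \<delta>g))"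
    using mu_pos delta by (simp add: power_mult_distrib tau_max_square root_g_def)
  have "(1 / 6)\<^sup>2 \<le> \<delta>g / (3 * (\<delta>f + \<delta>g))" "\<delta>g / (3 * (\<delta>f + \<delta>g)) \<le> (2 / 3)\<^sup>2"
    using mu_pos delta by (simp_all add: power2_eq_square field_simps)
  then show "1 / 6 \<le> root_g * tau_max" "root_g * tau_max \<le> 2 / 3"
    unfolding square[symmetric] using roots tau_max_bounds
    by (auto intro: power2_le_imp_le[of _ "root_g * tau_max"] power2_le_imp_le[of "root_g * tau_max"])
qed

lemma schedule_parameters:
  assumes t: "\<And>k. 0 < t k" "\<And>k. t k \<le> tau_max" and \<pi>: "\<pi> = schedule \<mu> t share_f N"
  shows "admissible \<pi>"
    and "theta \<pi> k \<le> 1 / (3 * (\<delta>f + \<delta>g)) \<and> tau \<pi> k = sqrt (\<mu> * theta \<pi> k) \<and>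
         eta \<pi> k = min (1 / (2 * \<mu>)) (1 / 2 * sqrt (theta \<pi> k / \<mu>))"
    and "alpha \<pi> = \<mu>"
proof -
  have t1: "t k < 1" for k
    using t(2)[of k] tau_max_bounds by linarith
  have tT: "(t k)\<^sup>2 \<le> \<mu> / (3 * (\<delta>f + \<delta>g))" for k
    using power_mono[OF t(2)[of k] less_imp_le[OF t(1)[of k]], of 2] by (simp add: tau_max_square)
  show "admissible \<pi>"
    using t(1) t1 mu_pos share_f_bounds by (simp add: admissible_def \<pi> schedule_def less_imp_neq[symmetric])
  show "theta \<pi> k \<le> 1 / (3 * (\<delta>f + \<delta>g)) \<and> tau \<pi> k = sqrt (\<mu> * theta \<pi> k) \<and>
         eta \<pi> k = min (1 / (2 * \<mu>)) (1 / 2 * sqrt (theta \<pi> k / \<mu>))"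
    using tT[of k] t(1)[of k] mu_pos by (simp add: \<pi> schedule_def field_simps)
  show "alpha \<pi> = \<mu>"
    by (simp add: \<pi> schedule_def)
qed

text \<open>
  This separates the run from its schedule: it suffices that every real sequence obeying the
  recursion of the potential ends below \<open>\<epsilon>\<close>, or that \<open>x0\<close> itself is good enough.  The inequalities \<open>share_f / tau_max \<le> 2 root_f\<close> and
  \<open>(1 - share_f) / tau_max \<le> 2 root_g\<close> distribute the iterations over the two groups of nodes.
\<close>

lemma schedule_complexity:
  fixes P :: "'a::euclidean_space problem" and R :: "('w, 'a) run"
  assumes t: "\<And>k. 0 < t k" "\<And>k. t k \<le> tau_max" "\<And>k. t k \<le> 2 * t (Suc k)" and \<pi>: "\<pi> = schedule \<mu> t share_f N"
    and accurate: "(\<forall>\<Phi> :: nat \<Rightarrow> real. \<Phi> 0 \<le> C0 \<longrightarrow>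
        (\<forall>k<N. \<Phi> (Suc k) \<le> (1 - t k / 2) * \<Phi> k + 3 * \<sigma>\<^sup>2 / \<mu> * (t k)\<^sup>2) \<longrightarrow> \<Phi> N \<le> \<epsilon>)
      \<or> N = 0 \<and> 2 / 3 * C0 \<le> \<epsilon>"
    and short: "real N \<le> 51 * l / tau_max + 50 * S" and pos: "0 \<le> l" "0 \<le> S"
    and problem: "composite_problem P" "strongly_convex \<mu> (obj_h P)"
      "hessian_similar \<delta>f (server_f P) (obj_f P)" "hessian_similar \<delta>g (server_g P) (obj_g P)"
      "initial_error P \<mu> x0 \<le> C0"
    and run: "sc_acc_extragradient P \<pi> x0 R" "bounded_oracle_variance P \<pi> R \<sigma>"
      "subproblems_solved P \<pi> R"
  shows "eps_solution P \<pi> R \<mu> \<epsilon>"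
    and "(\<integral>\<omega>. real (rounds_f \<pi> R \<omega>) \<partial>law R) \<le> abs_const * (root_f * l + S)"
    and "(\<integral>\<omega>. real (rounds_g \<pi> R \<omega>) \<partial>law R) \<le> abs_const * (root_g * l + S)"
proof -
  note params = schedule_parameters[OF t(1,2) \<pi>]
  have tau: "tau \<pi> = t" "iters \<pi> = N" "prob_f \<pi> = share_f"
    by (simp_all add: \<pi> schedule_def)
  interpret similar: similar_run P \<mu> \<delta>f \<delta>g \<pi> x0 R \<sigma>
    using params t(3) problem run mu_pos delta
    by unfold_locales (simp_all add: tau)
  show "eps_solution P \<pi> R \<mu> \<epsilon>"
  proof (cases "N = 0 \<and> 2 / 3 * C0 \<le> \<epsilon>")
    case True
    then show ?thesis
      using similar.eps_solution_initial[of \<epsilon>] problem(5) by (simp add: tau)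
  next
    case False
    have "similar.potential (Suc k) \<le> (1 - t k / 2) * similar.potential k + 3 * \<sigma>\<^sup>2 / \<mu> * (t k)\<^sup>2" if "k < N" for k
      using similar.potential_Suc[of k] similar.invariant[of k] that by (simp add: tau)
    moreover have "similar.potential 0 \<le> C0"
      using similar.potential_0 problem(5) by linarith
    ultimately have "similar.potential N \<le> \<epsilon>"
      using False accurate by blast
    then show ?thesis
      by (intro similar.eps_solution_if_potential_le) (simp add: tau)
  qed
  have rounds: "2 * q * real N \<le> abs_const * (Z * l + S)" if q: "0 \<le> q" "q \<le> 1" "q * (root_f + root_g) = Z" for q Z
  proof -
    have "q / tau_max \<le> q * (2 * (root_f + root_g))"
      using mult_left_mono[OF inverse_tau_max q(1)] by simp
    also have "\<dots> = 2 * Z" using q(3) by (simp add: algebra_simps)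
    finally have qT: "q / tau_max \<le> 2 * Z" .
    have "2 * q * real N \<le> 2 * q * (51 * l / tau_max + 50 * S)"
      using short q by (intro mult_left_mono) simp_all
    also have "\<dots> = 102 * l * (q / tau_max) + 100 * (q * S)"
      by (simp add: algebra_simps)
    also have "\<dots> \<le> 102 * l * (2 * Z) + 100 * (1 * S)"
      using qT q pos by (intro add_mono mult_left_mono mult_right_mono) simp_all
    also have "\<dots> \<le> 1000 * (Z * l + S)"
    proof -
      have "0 \<le> Z * l" using q roots pos by (metis add_nonneg_nonneg less_imp_le less_trans mult_nonneg_nonneg zero_less_one)
      then show ?thesis using pos by (simp add: algebra_simps)
    qed
    finally show ?thesis by (simp add: abs_const_def)
  qed
  have roots_nz: "root_f + root_g \<noteq> 0" using roots by simp
  show "(\<integral>\<omega>. real (rounds_f \<pi> R \<omega>) \<partial>law R) \<le> abs_const * (root_f * l + S)"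
    unfolding similar.expected_rounds tau using share_f_bounds roots_nz by (intro rounds) (simp_all add: share_f_def)
  show "(\<integral>\<omega>. real (rounds_g \<pi> R \<omega>) \<partial>law R) \<le> abs_const * (root_g * l + S)"
  proof -
    have "(1 - share_f) * (root_f + root_g) = root_g"
      using roots_nz by (simp add: share_f_def field_simps)
    then show ?thesis
      unfolding similar.expected_rounds tau using share_f_bounds by (intro rounds) simp_all
  qed
qed

text \<open>
  The step size \<open>tau_max / 8\<close> puts the noise floor below \<open>\<epsilon> / 2\<close>.  If \<open>\<epsilon>\<close> is below two thirds of \<open>C0\<close>, the
  iterations reduce the initial error to \<open>\<epsilon> / 2\<close>; the constant \<open>51 = 3 * 16 + 3\<close> absorbs \<open>ln 2\<close> and the
  rounding up, because then \<open>C0 / \<epsilon> \<ge> 3 / 2\<close>.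
\<close>

lemma constant_schedule_exists:
  fixes \<sigma> \<epsilon> C0 :: real
  assumes eps: "0 < \<epsilon>" "\<epsilon> < C0" and small_noise: "\<sigma>\<^sup>2 / (\<mu> * \<epsilon>) \<le> root_g"
  shows "\<exists>N. real N \<le> 51 * ln (C0 / \<epsilon>) / tau_max \<and> ((\<forall>\<Phi> :: nat \<Rightarrow> real. \<Phi> 0 \<le> C0 \<longrightarrow>
        (\<forall>k<N. \<Phi> (Suc k) \<le> (1 - tau_max / 8 / 2) * \<Phi> k + 3 * \<sigma>\<^sup>2 / \<mu> * (tau_max / 8)\<^sup>2) \<longrightarrow> \<Phi> N \<le> \<epsilon>)
      \<or> N = 0 \<and> 2 / 3 * C0 \<le> \<epsilon>)"
proof (cases "2 / 3 * C0 \<le> \<epsilon>")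
  case True
  then show ?thesis
    using eps tau_max_bounds by (intro exI[of _ 0]) (simp add: ln_ge_zero)
next
  case False
  let ?l = "ln (C0 / \<epsilon>)" and ?c = "3 * \<sigma>\<^sup>2 / \<mu>"
  define N where "N = nat \<lceil>16 / tau_max * ln (2 * C0 / \<epsilon>)\<rceil>"
  have ratio: "3 / 2 \<le> C0 / \<epsilon>"
    using False eps by (simp add: field_simps)
  have "ln (3 / 2) \<le> ?l"
    using ratio eps by (subst ln_le_cancel_iff) simp_all
  moreover have "1 - 1 / (3 / 2) \<le> ln (3 / 2 :: real)"
    using ln_le_minus_one[of "2 / 3 :: real"] by (simp add: ln_div)
  moreover have "ln 2 \<le> 2 * ln (3 / 2 :: real)"
  proof -
    have "ln 2 \<le> ln ((3 / 2)\<^sup>2 :: real)" by (subst ln_le_cancel_iff) (simp_all add: power2_eq_square)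
    then show ?thesis by (simp add: ln_realpow)
  qed
  moreover have ln2: "ln (2 * C0 / \<epsilon>) = ln 2 + ?l"
    using eps ln_mult[of 2 "C0 / \<epsilon>"] by simp
  ultimately have lam: "1 / 3 \<le> ?l" "0 \<le> ln (2 * C0 / \<epsilon>)" "ln (2 * C0 / \<epsilon>) \<le> 3 * ?l"
    by simp_all
  have N: "16 / tau_max * ln (2 * C0 / \<epsilon>) \<le> N" "N \<le> 16 / tau_max * ln (2 * C0 / \<epsilon>) + 1"
    using lam tau_max_bounds by (auto simp: N_def intro!: real_nat_ceiling_ge of_nat_ceiling)
  have "1 \<le> 3 * ?l / tau_max"
    using lam(1) tau_max_bounds by (simp add: pos_le_divide_eq)
  moreover have "16 / tau_max * ln (2 * C0 / \<epsilon>) \<le> 16 / tau_max * (3 * ?l)"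
    using lam tau_max_bounds by (intro mult_left_mono) simp_all
  ultimately have short: "real N \<le> 51 * ?l / tau_max"
    using N(2) by (simp only: times_divide_eq_left times_divide_eq_right)
  have "\<Phi> N \<le> \<epsilon>" if "\<Phi> 0 \<le> C0" "\<forall>k<N. \<Phi> (Suc k) \<le> (1 - tau_max / 8 / 2) * \<Phi> k + ?c * (tau_max / 8)\<^sup>2"
    for \<Phi> :: "nat \<Rightarrow> real"
  proof -
    have "\<Phi> N \<le> exp (- (tau_max / 8 * N / 2)) * C0 + 2 * ?c * (tau_max / 8)"
      using that eps tau_max_bounds mu_pos by (intro constant_schedule_bound) simp_all
    also have "exp (- (tau_max / 8 * N / 2)) \<le> exp (- ln (2 * C0 / \<epsilon>))"
      using N(1) tau_max_bounds by (simp add: field_simps)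
    also have "exp (- ln (2 * C0 / \<epsilon>)) = \<epsilon> / (2 * C0)"
      using eps by (simp add: exp_minus)
    also have "\<epsilon> / (2 * C0) * C0 = \<epsilon> / 2"
      using eps by simp
    also have "2 * ?c * (tau_max / 8) = 3 / 4 * \<epsilon> * (\<sigma>\<^sup>2 / (\<mu> * \<epsilon>) * tau_max)"
      using eps by simp
    also have "\<dots> \<le> 3 / 4 * \<epsilon> * (root_g * tau_max)"
      using small_noise eps tau_max_bounds by (intro mult_left_mono mult_right_mono) simp_all
    also have "\<dots> \<le> 3 / 4 * \<epsilon> * (2 / 3)"
      using root_g_tau_max eps by (intro mult_left_mono) simp_all
    finally show ?thesis using eps by simp
  qed
  with short show ?thesis by blast
qed

text \<open>
  The largest step size is kept until the error has come down to its noise floor.  From then on the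
  harmonic step sizes lower the error like \<open>1 / k\<close>, without a logarithm, until the bound
  \<open>4 c t\<^sub>k\<close> with \<open>c = 3 \<epsilon> S\<close>, \<open>S = \<sigma>\<^sup>2 / (\<mu> \<epsilon>)\<close>, has reached \<open>\<epsilon>\<close>.
\<close>

lemma harmonic_schedule_exists:
  fixes \<sigma> \<epsilon> C0 :: real
  assumes eps: "0 < \<epsilon>" "\<epsilon> < C0" and large_noise: "root_g \<le> \<sigma>\<^sup>2 / (\<mu> * \<epsilon>)"
  shows "\<exists>t N. (\<forall>k. 0 < t k \<and> t k \<le> tau_max \<and> t k \<le> 2 * t (Suc k)) \<and>
    real N \<le> 51 * ln (C0 / \<epsilon>) / tau_max + 50 * (\<sigma>\<^sup>2 / (\<mu> * \<epsilon>)) \<and> (\<forall>\<Phi> :: nat \<Rightarrow> real. \<Phi> 0 \<le> C0 \<longrightarrow>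
        (\<forall>k<N. \<Phi> (Suc k) \<le> (1 - t k / 2) * \<Phi> k + 3 * \<sigma>\<^sup>2 / \<mu> * (t k)\<^sup>2) \<longrightarrow> \<Phi> N \<le> \<epsilon>)"
proof -
  let ?l = "ln (C0 / \<epsilon>)" and ?c = "3 * \<sigma>\<^sup>2 / \<mu>" and ?S = "\<sigma>\<^sup>2 / (\<mu> * \<epsilon>)" and ?m = "4 / tau_max"
  define N1 where "N1 = nat \<lceil>2 / tau_max * ?l\<rceil>"
  \<comment> \<open>the second phase ends when \<open>4 c (4 / N2) \<le> \<epsilon>\<close>, and \<open>16 c = 48 \<epsilon> S\<close>\<close>
  define N2 where "N2 = nat \<lceil>48 * ?S\<rceil>"
  \<comment> \<open>truncated subtraction: the value is \<open>tau_max\<close> up to index \<open>N1\<close>, where the harmonic decay sets in\<close>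
  define t where "t k = 4 / (real (k - N1) + ?m)" for k
  have lam: "0 \<le> ?l" using eps by (simp add: ln_ge_zero)
  have m: "4 \<le> ?m" using tau_max_bounds by (simp add: pos_le_divide_eq)
  have S: "1 \<le> ?S" using large_noise roots by linarith
  have N1: "2 / tau_max * ?l \<le> N1" "N1 \<le> 2 / tau_max * ?l + 1"
    using lam tau_max_bounds by (auto simp: N1_def intro!: real_nat_ceiling_ge of_nat_ceiling)
  have N2: "48 * ?S \<le> N2" "N2 \<le> 48 * ?S + 1"
    using S by (auto simp: N2_def intro!: real_nat_ceiling_ge of_nat_ceiling)
  have t_pos: "0 < t k" for k
    using m by (simp add: t_def add_nonneg_pos)
  have t_T: "t k \<le> tau_max" for k
  proof -
    have "t k \<le> 4 / ?m"
      unfolding t_def using m tau_max_bounds by (intro divide_left_mono mult_pos_pos) (simp_all add: add_nonneg_pos)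
    then show ?thesis by simp
  qed
  have t_slow: "t k \<le> 2 * t (Suc k)" for k
  proof -
    have "real (Suc k - N1) + ?m \<le> 2 * (real (k - N1) + ?m)"
      using m by simp
    then show ?thesis
      using m unfolding t_def by (simp add: field_simps add_nonneg_pos)
  qed
  have "2 / tau_max * ?l \<le> 51 * ?l / tau_max"
    using lam tau_max_bounds by (simp add: divide_right_mono)
  moreover have "a + b \<le> d + 50 * s" if "c \<le> d" "a \<le> c + 1" "b \<le> 48 * s + 1" "1 \<le> s"
    for a b c d s :: real
    using that by linarith
  ultimately have short: "real (N1 + N2) \<le> 51 * ?l / tau_max + 50 * ?S"
    using N1(2) N2(2) S unfolding of_nat_add by blast
  have "\<Phi> (N1 + N2) \<le> \<epsilon>" if \<Phi>: "\<Phi> 0 \<le> C0"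
    "\<forall>k<N1 + N2. \<Phi> (Suc k) \<le> (1 - t k / 2) * \<Phi> k + ?c * (t k)\<^sup>2" for \<Phi> :: "nat \<Rightarrow> real"
  proof -
    have c: "?c = 3 * \<epsilon> * ?S" "0 \<le> ?c"
      using eps mu_pos by simp_all
    have "\<Phi> N1 \<le> exp (- (tau_max * N1 / 2)) * C0 + 2 * ?c * tau_max"
    proof (rule constant_schedule_bound)
      fix k assume "k < N1"
      then show "\<Phi> (Suc k) \<le> (1 - tau_max / 2) * \<Phi> k + ?c * tau_max\<^sup>2"
        using \<Phi>(2)[rule_format, of k] by (simp add: t_def)
    qed (use \<Phi>(1) eps tau_max_bounds c(2) in simp_all)
    also have "exp (- (tau_max * N1 / 2)) * C0 \<le> exp (- ?l) * C0"
      using N1(1) tau_max_bounds eps by (intro mult_right_mono) (simp_all add: field_simps)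
    also have "exp (- ?l) * C0 = \<epsilon>"
      using eps by (simp add: exp_minus)
    also have "\<epsilon> \<le> 2 * ?c * tau_max"
    proof -
      have "1 / 6 \<le> ?S * tau_max"
        using root_g_tau_max(1) mult_right_mono[OF large_noise, of tau_max] tau_max_bounds by linarith
      from mult_left_mono[OF this, of "6 * \<epsilon>"] eps show ?thesis unfolding c(1) by simp
    qed
    finally have start: "\<Phi> N1 \<le> 4 * ?c * tau_max" by (simp add: mult_ac)
    have "\<Phi> (N1 + N2) \<le> 4 * ?c * (4 / (real N2 + ?m))"
    proof (rule harmonic_schedule_bound[where \<Phi> = "\<lambda>j. \<Phi> (N1 + j)"])
      fix j assume "j < N2"
      then show "\<Phi> (N1 + Suc j) \<le> (1 - 4 / (real j + ?m) / 2) * \<Phi> (N1 + j) + ?c * (4 / (real j + ?m))\<^sup>2"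
        using \<Phi>(2)[rule_format, of "N1 + j"] by (simp add: t_def)
    qed (use start c m in simp_all)
    also have "\<dots> = \<epsilon> * (48 * ?S / (real N2 + ?m))"
      unfolding c(1) by simp
    also have "\<dots> \<le> \<epsilon> * 1"
    proof (intro mult_left_mono)
      have "0 < real N2 + ?m" using m by (simp add: add_nonneg_pos)
      then have den: "(48 * ?S / (real N2 + ?m) \<le> 1) = (48 * ?S \<le> 1 * (real N2 + ?m))"
        by (rule pos_divide_le_eq)
      show "48 * ?S / (real N2 + ?m) \<le> 1"
        unfolding den by (rule order_trans[OF N2(1)]) (use tau_max_bounds in simp)
    qed (use eps in simp)
    finally show ?thesis by simp
  qed
  with t_pos t_T t_slow short show ?thesis by blast
qed

end

theorem theorem1:
  fixes \<mu> \<delta>f \<delta>g \<sigma> \<epsilon> C0 :: real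
  assumes "0 < \<mu>" "\<mu> < \<delta>f" "\<delta>f < \<delta>g" "0 < \<epsilon>" "\<epsilon> < C0"
  shows "\<exists>\<pi>. admissible \<pi> \<and>
    (\<forall>k. theta \<pi> k \<le> 1 / (3 * (\<delta>f + \<delta>g)) \<and>
         tau \<pi> k = sqrt (\<mu> * theta \<pi> k) \<and>
         eta \<pi> k = min (1 / (2 * \<mu>)) (1 / 2 * sqrt (theta \<pi> k / \<mu>))) \<and>
    alpha \<pi> = \<mu> \<and>
    (\<sigma>\<^sup>2 / (\<mu> * \<epsilon>) \<le> sqrt (\<delta>g / \<mu>) \<longrightarrow> constant_params \<pi>) \<and>
    (\<forall>(P :: 'a::euclidean_space problem) x0 (R :: ('w, 'a) run).
       composite_problem P \<and>
       strongly_convex \<mu> (obj_h P) \<and>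
       hessian_similar \<delta>f (server_f P) (obj_f P) \<and>
       hessian_similar \<delta>g (server_g P) (obj_g P) \<and>
       initial_error P \<mu> x0 \<le> C0 \<and>
       sc_acc_extragradient P \<pi> x0 R \<and>
       bounded_oracle_variance P \<pi> R \<sigma> \<and>
       subproblems_solved P \<pi> R
       \<longrightarrow>
       eps_solution P \<pi> R \<mu> \<epsilon> \<and>
       (\<integral>\<omega>. real (rounds_f \<pi> R \<omega>) \<partial>law R)
         \<le> abs_const * (sqrt (\<delta>f / \<mu>) * ln (C0 / \<epsilon>) + \<sigma>\<^sup>2 / (\<mu> * \<epsilon>)) \<and>
       (\<integral>\<omega>. real (rounds_g \<pi> R \<omega>) \<partial>law R)
         \<le> abs_const * (sqrt (\<delta>g / \<mu>) * ln (C0 / \<epsilon>) + \<sigma>\<^sup>2 / (\<mu> * \<epsilon>)))"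
proof -
  interpret step_sizes \<mu> \<delta>f \<delta>g
    using assms(1-3) by unfold_locales
  let ?S = "\<sigma>\<^sup>2 / (\<mu> * \<epsilon>)" and ?l = "ln (C0 / \<epsilon>)"
  have pos: "0 \<le> ?l" "0 \<le> ?S"
    using assms by (simp_all add: ln_ge_zero)
  obtain t N where t: "\<And>k. 0 < t k" "\<And>k. t k \<le> tau_max" "\<And>k. t k \<le> 2 * t (Suc k)"
    and short: "real N \<le> 51 * ?l / tau_max + 50 * ?S"
    and accurate: "(\<forall>\<Phi> :: nat \<Rightarrow> real. \<Phi> 0 \<le> C0 \<longrightarrow>
        (\<forall>k<N. \<Phi> (Suc k) \<le> (1 - t k / 2) * \<Phi> k + 3 * \<sigma>\<^sup>2 / \<mu> * (t k)\<^sup>2) \<longrightarrow> \<Phi> N \<le> \<epsilon>)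
      \<or> N = 0 \<and> 2 / 3 * C0 \<le> \<epsilon>"
    and const_t: "?S \<le> root_g \<Longrightarrow> \<forall>k. t k = t 0"
  proof (cases "?S \<le> root_g")
    case True
    obtain N where N_short: "real N \<le> 51 * ?l / tau_max" and N: "(\<forall>\<Phi> :: nat \<Rightarrow> real. \<Phi> 0 \<le> C0 \<longrightarrow>
        (\<forall>k<N. \<Phi> (Suc k) \<le> (1 - tau_max / 8 / 2) * \<Phi> k + 3 * \<sigma>\<^sup>2 / \<mu> * (tau_max / 8)\<^sup>2) \<longrightarrow> \<Phi> N \<le> \<epsilon>)
      \<or> N = 0 \<and> 2 / 3 * C0 \<le> \<epsilon>"
      using constant_schedule_exists[OF assms(4,5) True] by (elim exE conjE) (rule that)
    show ?thesis
    proof (intro that[of "\<lambda>_. tau_max / 8" N])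
      show "real N \<le> 51 * ?l / tau_max + 50 * ?S"
        using N_short pos(2) by linarith
      show "0 < tau_max / 8" "tau_max / 8 \<le> tau_max" "tau_max / 8 \<le> 2 * (tau_max / 8)"
        using tau_max_bounds by simp_all
      show "\<forall>k. tau_max / 8 = tau_max / 8" by simp
    qed (fact N)
  next
    case False
    then have large: "root_g \<le> ?S" by simp
    obtain t N where *: "\<forall>k. 0 < t k \<and> t k \<le> tau_max \<and> t k \<le> 2 * t (Suc k)"
      "real N \<le> 51 * ?l / tau_max + 50 * ?S" "\<forall>\<Phi> :: nat \<Rightarrow> real. \<Phi> 0 \<le> C0 \<longrightarrow>
        (\<forall>k<N. \<Phi> (Suc k) \<le> (1 - t k / 2) * \<Phi> k + 3 * \<sigma>\<^sup>2 / \<mu> * (t k)\<^sup>2) \<longrightarrow> \<Phi> N \<le> \<epsilon>"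
      using harmonic_schedule_exists[OF assms(4,5) large] by (elim exE conjE) (rule that)
    show ?thesis
      by (rule that[of t N]) (use * False in \<open>blast+\<close>)
  qed
  define \<pi> where "\<pi> = schedule \<mu> t share_f N"
  show ?thesis
  proof (intro exI[of _ \<pi>] conjI allI impI; (elim conjE)?)
    note params = schedule_parameters[where t = t, OF t(1,2) \<pi>_def]
    show "admissible \<pi>" "alpha \<pi> = \<mu>"
      using params by blast+
    show "theta \<pi> k \<le> 1 / (3 * (\<delta>f + \<delta>g))"
      "tau \<pi> k = sqrt (\<mu> * theta \<pi> k)"
      "eta \<pi> k = min (1 / (2 * \<mu>)) (1 / 2 * sqrt (theta \<pi> k / \<mu>))"
      for k using params by blast+
    show "constant_params \<pi>" if "?S \<le> sqrt (\<delta>g / \<mu>)"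
    proof -
      have "?S \<le> root_g" using that by (simp only: root_g_def)
      from const_t[OF this] have "\<exists>c. \<forall>k. t k = c" by blast
      then obtain c where "\<And>k. t k = c" by blast
      then show ?thesis by (simp add: constant_params_def schedule_def \<pi>_def)
    qed
    fix P :: "'a problem" and x0 and R :: "('w, 'a) run"
    assume A: "composite_problem P" "strongly_convex \<mu> (obj_h P)"
      "hessian_similar \<delta>f (server_f P) (obj_f P)" "hessian_similar \<delta>g (server_g P) (obj_g P)"
      "initial_error P \<mu> x0 \<le> C0" "sc_acc_extragradient P \<pi> x0 R"
      "bounded_oracle_variance P \<pi> R \<sigma>" "subproblems_solved P \<pi> R"
    note complexity = schedule_complexity[where t = t, OF t \<pi>_def accurate short pos A]
    show "eps_solution P \<pi> R \<mu> \<epsilon>"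
      by (rule complexity)
    show "(\<integral>\<omega>. real (rounds_f \<pi> R \<omega>) \<partial>law R)
         \<le> abs_const * (sqrt (\<delta>f / \<mu>) * ln (C0 / \<epsilon>) + \<sigma>\<^sup>2 / (\<mu> * \<epsilon>))"
      using complexity(2) by (simp add: root_f_def)
    show "(\<integral>\<omega>. real (rounds_g \<pi> R \<omega>) \<partial>law R)
         \<le> abs_const * (sqrt (\<delta>g / \<mu>) * ln (C0 / \<epsilon>) + \<sigma>\<^sup>2 / (\<mu> * \<epsilon>))"
      using complexity(3) by (simp add: root_g_def)
  qed
qed

end
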